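(* Let $m\ge 2$ and $n\ge 2$ be integers, let $T$ be a tree on $n$ vertices, and let $G=T\,\Box\,K_m$ be the Cartesian product of $T$ with the complete graph $K_m$ on $m$ vertices. Then $G$ is just a frame graph in the inner product spaces of dimension $mn-m,mn-m+1,\dots,mn-1,mn$; that is, for each $\mathbb{F}\in\{\mathbb{R},\mathbb{C}\}$ and each integer $d\ge1$, $G$ is a frame graph in a $d$-dimensional inner product space over $\mathbb{F}$ if and only if $mn-m\le d\le mn$.
   Context: All graphs are finite, simple, connected and have more than one vertex. A finite frame for a finite-dimensional inner product space $\mathcal{H}$ over $\mathbb{R}$ or $\mathbb{C}$ is a finite sequence $\varphi=(f_i)_{i=1}^N$ in $\mathcal{H}$ for which there are constants $0<A\le B<\infty$ with $A\|f\|^2\le\sum_{i=1}^N|\langle f,f_i\rangle|^2\le B\|f\|^2$ for all $f\in\mathcal{H}$ (equivalently, a finite sequence spanning $\mathcal{H}$; repeated vectors are allowed and count as different vertices). Its frame graph $G(\varphi)$ has the elements $f_1,\dots,f_N$ of the sequence as vertices, and for $i\ne j$, $f_i$ and $f_j$ are adjacent iff $\langle f_i,f_j\rangle\ne 0$. A graph $G$ is a frame graph in $\mathcal{H}$ if there is a finite frame $\varphi$ for $\mathcal{H}$ with $G(\varphi)=G$ (up to labelling of vertices). The Cartesian product $G_1\,\Box\,G_2$ of $G_1=(V_1,E_1)$ and $G_2=(V_2,E_2)$ has vertex set $V_1\times V_2$, with $(u,v)$ adjacent to $(u',v')$ iff (1) $u=u'$ and $\{v,v'\}\in E_2$, or (2)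 $v=v'$ and $\{u,u'\}\in E_1$. *)

theory Defs
  imports
    "HOL-Computational_Algebra.Polynomial"
    "Graph_Theory.Graph_Theory"
    "Jordan_Normal_Form.Conjugate"
begin

section \<open>Inner product spaces over the real or complex numbers\<close>

text \<open>
  The space is a linear subspace \<open>H\<close> of an arbitrary vector space, so that spaces of every
  dimension can live in one type. The inner product is linear in its first argument. Only the
  instances \<open>real\<close> and \<open>complex\<close> of the scalar type are intended; there \<open>conjugate\<close> is the identity
  and \<open>cnj\<close>, respectively, and for complex scalars \<open>0 < z\<close> means that \<open>z\<close> is real and positive.
\<close>

locale inner_product_space = vector_space scale
  for scale :: "'f::{real_normed_field, conjugatable_ordered_field} \<Rightarrow> 'v::ab_group_add \<Rightarrow> 'v" +
  fixes ip :: "'v \<Rightarrow> 'v \<Rightarrow> 'f" and H :: "'v set"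
  assumes subspace_H: "subspace H"
    and ip_add_left: "\<lbrakk>x \<in> H; y \<in> H; z \<in> H\<rbrakk> \<Longrightarrow> ip (x + y) z = ip x z + ip y z"
    and ip_scale_left: "\<lbrakk>x \<in> H; y \<in> H\<rbrakk> \<Longrightarrow> ip (scale c x) y = c * ip x y"
    and ip_commute: "\<lbrakk>x \<in> H; y \<in> H\<rbrakk> \<Longrightarrow> ip y x = conjugate (ip x y)"
    and ip_pos: "\<lbrakk>x \<in> H; x \<noteq> 0\<rbrakk> \<Longrightarrow> 0 < ip x x"

text \<open>
  Every dimension is attained, already inside the single type \<open>'f poly\<close>: take the polynomials of
  degree less than \<open>d\<close> with the standard inner product of their coefficient vectors. So a statement
  about all \<open>d\<close>-dimensional inner product spaces is never vacuous.
\<close>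

lemma inner_product_space_exists:
  fixes d :: nat
  shows "\<exists>(scale :: 'f::{real_normed_field, conjugatable_ordered_field} \<Rightarrow> 'f poly \<Rightarrow> 'f poly) ip H.
           inner_product_space scale ip H \<and> vector_space.dim scale H = d"
proof -
  define ip :: "'f poly \<Rightarrow> 'f poly \<Rightarrow> 'f"
    where "ip = (\<lambda>p q. \<Sum>i<d. coeff p i * conjugate (coeff q i))"
  define H :: "'f poly set" where "H = {p. \<forall>i\<ge>d. coeff p i = 0}"
  define e :: "nat \<Rightarrow> 'f poly" where "e = (\<lambda>i. monom 1 i)"
  interpret vector_space "smult :: 'f \<Rightarrow> 'f poly \<Rightarrow> 'f poly"
    by unfold_locales (auto simp: smult_add_right smult_add_left)
  have subH: "subspace H"
    by (auto simp: subspace_def H_def)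
  have ips: "inner_product_space smult ip H"
  proof (unfold_locales, goal_cases)
    case 1
    show ?case by (rule subH)
  next
    case (2 x y z)
    show ?case by (simp add: ip_def sum.distrib algebra_simps)
  next
    case (3 x y c)
    show ?case by (simp add: ip_def sum_distrib_left algebra_simps)
  next
    case (4 x y)
    show ?case by (simp add: ip_def sum_conjugate conjugate_dist_mul mult.commute)
  next
    case (5 x)
    have nonneg: "0 \<le> coeff x i * conjugate (coeff x i)" for i
      by (rule conjugate_square_positive)
    have "ip x x \<noteq> 0"
    proof
      assume "ip x x = 0"
      then have "\<forall>i<d. coeff x i * conjugate (coeff x i) = 0"
        unfolding ip_def using nonneg by (subst (asm) sum_nonneg_eq_0_iff) auto
      then have "\<forall>i<d. coeff x i = 0" by (auto dest: conjugate_square_0)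
      then have "x = 0"
        using 5(1) by (intro poly_eqI) (metis (mono_tags, lifting) H_def coeff_0 mem_Collect_eq not_le)
      with 5(2) show False by simp
    qed
    moreover have "0 \<le> ip x x"
      unfolding ip_def using nonneg by (intro sum_nonneg) auto
    ultimately show ?case by (simp add: order_less_le)
  qed
  have inj: "inj_on e {..<d}"
    by (auto simp: inj_on_def e_def monom_eq_iff')
  have expand: "coeff (\<Sum>v\<in>e ` {..<d}. smult (u v) v) j = (if j < d then u (e j) else 0)" for u j
  proof -
    have "coeff (\<Sum>v\<in>e ` {..<d}. smult (u v) v) j = (\<Sum>i<d. coeff (smult (u (e i)) (e i)) j)"
      by (simp add: sum.reindex[OF inj] coeff_sum)
    also have "\<dots> = (\<Sum>i<d. if i = j then u (e j) else 0)"
      by (rule sum.cong) (auto simp: e_def)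
    finally have "coeff (\<Sum>v\<in>e ` {..<d}. smult (u v) v) j = (\<Sum>i<d. if i = j then u (e j) else 0)" .
    then show ?thesis by simp
  qed
  have "independent (e ` {..<d})"
  proof (rule independent_if_scalars_zero)
    fix f x assume s: "(\<Sum>x\<in>e ` {..<d}. smult (f x) x) = 0" and "x \<in> e ` {..<d}"
    then obtain j where j: "j < d" "x = e j" by auto
    show "f x = 0" using expand[of f j] s j by simp
  qed simp
  moreover have "e ` {..<d} \<subseteq> H"
    by (auto simp: e_def H_def)
  moreover have "H \<subseteq> span (e ` {..<d})"
  proof
    fix p assume p: "p \<in> H"
    have "p = (\<Sum>v\<in>e ` {..<d}. smult (coeff p (degree v)) v)"
      using p by (intro poly_eqI) (auto simp: expand H_def, simp add: e_def degree_monom_eq)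
    then show "p \<in> span (e ` {..<d})"
      by (metis (no_types, lifting) span_base span_scale span_sum)
  qed
  moreover have "card (e ` {..<d}) = d"
    by (simp add: card_image inj)
  ultimately have "dim H = d" by (intro dim_unique)
  with ips show ?thesis by blast
qed


section \<open>Frames and frame graphs\<close>

text \<open>
  A sequence is a list, so repeated vectors count with multiplicity.
  The squared norm of \<open>f\<close> is \<open>norm (ip f f)\<close>, where \<open>norm\<close> is the absolute value of scalars.
\<close>

definition finite_frame ::
  "('v \<Rightarrow> 'v \<Rightarrow> 'f::real_normed_field) \<Rightarrow> 'v set \<Rightarrow> 'v list \<Rightarrow> bool" where
  "finite_frame ip H \<phi> \<longleftrightarrow> set \<phi> \<subseteq> H \<and>
     (\<exists>A B :: real. 0 < A \<and> A \<le> B \<and>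
        (\<forall>f\<in>H. A * norm (ip f f) \<le> (\<Sum>i<length \<phi>. (norm (ip f (\<phi> ! i)))\<^sup>2) \<and>
               (\<Sum>i<length \<phi>. (norm (ip f (\<phi> ! i)))\<^sup>2) \<le> B * norm (ip f f)))"

text \<open>
  A simple graph is represented as a \<^locale>\<open>pair_graph\<close>: each edge \<open>{u, v}\<close> is given by the two
  arcs \<open>(u, v)\<close> and \<open>(v, u)\<close>.
\<close>

definition frame_graph ::
  "('v \<Rightarrow> 'v \<Rightarrow> 'f::real_normed_field) \<Rightarrow> 'v list \<Rightarrow> nat pair_pre_digraph" where
  "frame_graph ip \<phi> = \<lparr> pverts = {..<length \<phi>},
     parcs = {(i, j). i < length \<phi> \<and> j < length \<phi> \<and> i \<noteq> j \<and> ip (\<phi> ! i) (\<phi> ! j) \<noteq> 0} \<rparr>"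

definition is_frame_graph_in ::
  "'a pair_pre_digraph \<Rightarrow> ('v \<Rightarrow> 'v \<Rightarrow> 'f::real_normed_field) \<Rightarrow> 'v set \<Rightarrow> bool" where
  "is_frame_graph_in G ip H \<longleftrightarrow>
     (\<exists>\<phi>. finite_frame ip H \<phi> \<and> digraph_iso (with_proj (frame_graph ip \<phi>)) (with_proj G))"


section \<open>Trees and Cartesian products\<close>

text \<open>
  The constant \<^const>\<open>Digraph_Component.tree\<close> cannot be used here: in a symmetric digraph it
  counts the closed walk \<open>u, v, u\<close> along a single edge as a cycle. The cycles of a simple
  undirected graph are the cycles of length at least 3.
\<close>

definition undirected_tree :: "'a pair_pre_digraph \<Rightarrow> bool" where
  "undirected_tree T \<longleftrightarrow> pair_graph T \<and> Digraph_Component.connected (with_proj T) \<and>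
     \<not> (\<exists>p. pre_digraph.cycle (with_proj T) p \<and> 3 \<le> length p)"

definition cartesian_product ::
  "'a pair_pre_digraph \<Rightarrow> 'b pair_pre_digraph \<Rightarrow> ('a \<times> 'b) pair_pre_digraph" where
  "cartesian_product G1 G2 = \<lparr> pverts = pverts G1 \<times> pverts G2,
     parcs = {((u, v), (u', v')).
       u \<in> pverts G1 \<and> v \<in> pverts G2 \<and> u' \<in> pverts G1 \<and> v' \<in> pverts G2 \<and>
       (u = u' \<and> (v, v') \<in> parcs G2 \<or> v = v' \<and> (u, u') \<in> parcs G1)} \<rparr>"

end

theory Submission
  imports Defs
begin

text \<open>
  Root \<open>T\<close> at a vertex \<open>r\<close>. In any frame with the given graph, the \<open>mn - m\<close> vectors off the copy
  \<open>{r} \<times> K\<^sub>m\<close> are linearly independent: in a vanishing combination of them, the coefficients vanish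
  copy by copy, moving away from the root. Indeed, once they vanish on all vertices before \<open>t\<close>, the part
  of the combination in the branch at \<open>t\<close> is orthogonal to the rest, hence is itself zero; and its inner
  product with the vector of \<open>(p t, v)\<close>, where \<open>p t\<close> is the parent of \<open>t\<close>, only involves \<open>(t, v)\<close>.

  Conversely, each non-root vertex \<open>t\<close> gets an \<open>m\<close>-dimensional block, which carries two dual bases
  \<open>P e\<^sub>v\<close> and \<open>P\<^sup>-\<^sup>1 e\<^sub>v\<close> (where no entry of \<open>P\<^sup>2\<close> and \<open>P\<^sup>-\<^sup>2\<close> vanishes), and the vector of \<open>(s, v)\<close> is the sum of \<open>P\<^sup>-\<^sup>1 e\<^sub>v\<close> in the block
  of \<open>s\<close> and \<open>P e\<^sub>v\<close> in the blocks of the children of \<open>s\<close>. This gives dimension \<open>mn - m\<close>; adding new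
  orthonormal vectors to \<open>k \<le> m\<close> of the vectors in the copy of the root raises it by \<open>k\<close>.
\<close>

section \<open>Finite-dimensional real and complex inner product spaces\<close>

text \<open>Both scalar axioms hold for the reals and for the complex numbers, so one argument
  serves both fields. They link \<open>conjugate\<close> and the order to \<open>norm\<close>, in
  which \<open>finite_frame\<close> is phrased.\<close>

locale rc_inner_product_space = inner_product_space scale ip H
  for scale :: "'f::{real_normed_field, conjugatable_ordered_field} \<Rightarrow> 'v::ab_group_add \<Rightarrow> 'v"
    and ip :: "'v \<Rightarrow> 'v \<Rightarrow> 'f" and H :: "'v set" +
  assumes mult_conjugate: "(x::'f) * conjugate x = of_real ((norm x)\<^sup>2)"
    and pos_of_real: "0 < (x::'f) \<Longrightarrow> x = of_real (norm x)"
begin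

lemma conjugate_of_real [simp]: "conjugate (of_real r :: 'f) = of_real r"
proof (cases "r = 0")
  case False
  have "(of_real r :: 'f) * conjugate (of_real r) = of_real r * of_real r"
    using mult_conjugate[of "of_real r"] by (simp add: power2_eq_square flip: of_real_mult)
  then show ?thesis using False by simp
qed simp

lemma norm_conjugate [simp]: "norm (conjugate (x :: 'f)) = norm x"
proof (cases "x = 0")
  case False
  have "norm x * norm (conjugate x) = norm x * norm x"
    using arg_cong[OF mult_conjugate[of x], of norm]
    by (simp only: norm_mult norm_of_real) (simp add: power2_eq_square)
  then show ?thesis using False by simp
qed simp

section \<open>Calculation rules for the inner product on H\<close>

lemma H_0 [simp]: "0 \<in> H"
  and H_add [simp]: "x \<in> H \<Longrightarrow> y \<in> H \<Longrightarrow> x + y \<in> H"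
  and H_diff [simp]: "x \<in> H \<Longrightarrow> y \<in> H \<Longrightarrow> x - y \<in> H"
  and H_scale [simp]: "x \<in> H \<Longrightarrow> scale c x \<in> H"
  using subspace_H by (auto intro: subspace_0 subspace_add subspace_diff subspace_scale)

lemma H_sum [simp]: "(\<And>i. i \<in> A \<Longrightarrow> f i \<in> H) \<Longrightarrow> sum f A \<in> H"
  by (rule subspace_sum[OF subspace_H])

lemma span_subset_H: "L \<subseteq> H \<Longrightarrow> span L \<subseteq> H"
  by (rule span_minimal[OF _ subspace_H])

lemma in_span_H: "x \<in> span L \<Longrightarrow> L \<subseteq> H \<Longrightarrow> x \<in> H"
  using span_subset_H by blast

lemma ip_0_left [simp]: "y \<in> H \<Longrightarrow> ip 0 y = 0"
  using ip_scale_left[of 0 y 0] by simp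

lemma ip_0_right [simp]: "x \<in> H \<Longrightarrow> ip x 0 = 0"
  using ip_commute[of 0 x] by simp

lemma ip_diff_left: "x \<in> H \<Longrightarrow> y \<in> H \<Longrightarrow> z \<in> H \<Longrightarrow> ip (x - y) z = ip x z - ip y z"
  using ip_add_left[of "x - y" y z] by simp

lemma ip_add_right: "x \<in> H \<Longrightarrow> y \<in> H \<Longrightarrow> z \<in> H \<Longrightarrow> ip z (x + y) = ip z x + ip z y"
  by (simp add: ip_commute[of _ z] ip_add_left conjugate_dist_add)

lemma ip_scale_right: "x \<in> H \<Longrightarrow> y \<in> H \<Longrightarrow> ip y (scale c x) = conjugate c * ip y x"
  by (simp add: ip_commute[of _ y] ip_scale_left conjugate_dist_mul)

lemma ip_sum_left: "(\<And>i. i \<in> A \<Longrightarrow> f i \<in> H) \<Longrightarrow> z \<in> H \<Longrightarrow> ip (sum f A) z = (\<Sum>i\<in>A. ip (f i) z)"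
  by (induction A rule: infinite_finite_induct) (simp_all add: ip_add_left)

lemma ip_sum_right: "(\<And>i. i \<in> A \<Longrightarrow> f i \<in> H) \<Longrightarrow> z \<in> H \<Longrightarrow> ip z (sum f A) = (\<Sum>i\<in>A. ip z (f i))"
  by (induction A rule: infinite_finite_induct) (simp_all add: ip_add_right)

lemma ip_self_eq_0_iff: "x \<in> H \<Longrightarrow> ip x x = 0 \<longleftrightarrow> x = 0"
  using ip_pos[of x] by (cases "x = 0") auto

lemma ip_eq_0_commute: "x \<in> H \<Longrightarrow> y \<in> H \<Longrightarrow> ip x y = 0 \<longleftrightarrow> ip y x = 0"
  using ip_commute[of x y] by auto

lemma ip_self: "x \<in> H \<Longrightarrow> ip x x = of_real (norm (ip x x))"
  using ip_pos[of x] pos_of_real by (cases "x = 0") auto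

lemma ip_span_eq_0:
  assumes "L \<subseteq> H" "x \<in> H" "\<And>y. y \<in> L \<Longrightarrow> ip x y = 0" "y \<in> span L"
  shows "ip x y = 0"
proof -
  have "subspace {y \<in> H. ip x y = 0}"
    using assms(2) by (auto simp: subspace_def ip_add_right ip_scale_right)
  then have "span L \<subseteq> {y \<in> H. ip x y = 0}"
    using assms(1,3) by (intro span_minimal) auto
  with assms(4) show ?thesis by auto
qed

text \<open>Gram-Schmidt by induction on L: if q is a projection of the new vector a onto the span
  of L, then a - q is orthogonal to L, and p is corrected by a multiple of a - q.\<close>

lemma projection_exists:
  assumes "finite L" "L \<subseteq> H" "x \<in> H"
  shows "\<exists>p\<in>span L. \<forall>y\<in>L. ip (x - p) y = 0"
  using assms
proof (induction L arbitrary: x rule: finite_induct)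
  case empty
  show ?case by (auto intro: span_zero)
next
  case (insert a L)
  then obtain q where q: "q \<in> span L" "\<forall>y\<in>L. ip (a - q) y = 0" by (meson insert_subset)
  from insert obtain p where p: "p \<in> span L" "\<forall>y\<in>L. ip (x - p) y = 0" by (meson insert_subset)
  have LH: "L \<subseteq> H" and aH: "a \<in> H" and xH: "x \<in> H" using insert by auto
  have qH: "q \<in> H" and pH: "p \<in> H" using p q LH in_span_H by blast+
  let ?a = "a - q"
  \<comment> \<open>If a - q = 0, division by zero makes c = 0; then a = q already lies in the span
    of L and p can stay as it is.\<close>
  define c where "c = ip (x - p) ?a / ip ?a ?a"
  let ?p = "p + scale c ?a"
  have aq: "?a \<in> H" using aH qH by simp
  have sub: "span L \<subseteq> span (insert a L)" by (rule span_mono) auto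
  have "?p \<in> span (insert a L)"
    using p q sub by (auto intro!: span_add span_scale span_diff intro: span_base)
  moreover have eq: "ip (x - ?p) y = ip (x - p) y - c * ip ?a y" if "y \<in> H" for y
  proof -
    have "x - ?p = (x - p) - scale c ?a" by simp
    then show ?thesis using that xH pH aq by (simp add: ip_diff_left ip_add_left ip_scale_left)
  qed
  have orthL: "ip (x - ?p) y = 0" if "y \<in> L" for y
    using that p q LH by (subst eq) auto
  moreover have "ip (x - ?p) a = 0"
  proof -
    have xpH: "x - ?p \<in> H" using xH pH aq by simp
    have "ip (x - ?p) q = 0" using ip_span_eq_0[OF LH xpH orthL q(1)] .
    moreover have "ip (x - ?p) ?a = 0"
    proof (cases "?a = 0")
      case True then show ?thesis using xpH by simp
    next
      case False
      then have "ip ?a ?a \<noteq> 0" using aq ip_self_eq_0_iff by blast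
      then show ?thesis using eq[OF aq] by (simp add: c_def)
    qed
    ultimately show ?thesis using ip_add_right[OF aq qH xpH] by simp
  qed
  ultimately show ?case by (intro bexI[of _ ?p]) auto
qed

text \<open>This makes failure to span usable: a vector outside the span minus its projection is
  nonzero and orthogonal to L. Spanning is later proved by contradiction with it.\<close>

lemma orthogonal_exists:
  assumes "finite L" "L \<subseteq> H" "\<not> H \<subseteq> span L"
  shows "\<exists>f\<in>H. f \<noteq> 0 \<and> (\<forall>y\<in>L. ip f y = 0)"
proof -
  from assms obtain x where x: "x \<in> H" "x \<notin> span L" by auto
  obtain p where p: "p \<in> span L" "\<forall>y\<in>L. ip (x - p) y = 0"
    using projection_exists[OF assms(1,2) x(1)] by blast
  show ?thesis
    using x p span_subset_H[OF assms(2)] by (intro bexI[of _ "x - p"]) auto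
qed

section \<open>Orthonormal bases and Parseval's identity\<close>

definition orthonormal :: "'v set \<Rightarrow> bool" where
  "orthonormal E \<longleftrightarrow> finite E \<and> E \<subseteq> H \<and> (\<forall>x\<in>E. \<forall>y\<in>E. ip x y = (if x = y then 1 else 0))"

lemma normalize_exists:
  assumes "f \<in> H" "f \<noteq> 0"
  shows "\<exists>c. ip (scale c f) (scale c f) = 1"
proof -
  let ?r = "norm (ip f f)"
  have r: "?r > 0" using assms ip_self_eq_0_iff by auto
  let ?c = "of_real (1 / sqrt ?r)"
  have "ip (scale ?c f) (scale ?c f) = of_real (1 / sqrt ?r * (1 / sqrt ?r)) * ip f f"
    using assms(1) by (simp only: ip_scale_left ip_scale_right H_scale conjugate_of_real of_real_mult mult.assoc)
  also have "\<dots> = of_real (1 / sqrt ?r * (1 / sqrt ?r)) * of_real ?r"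
    using ip_self[OF assms(1)] by simp
  also have "\<dots> = of_real (1 / sqrt ?r * (1 / sqrt ?r) * ?r)"
    by (simp only: of_real_mult)
  also have "1 / sqrt ?r * (1 / sqrt ?r) * ?r = 1" using r by (simp add: field_simps)
  finally show ?thesis by auto
qed

lemma orthonormal_extend:
  assumes "k \<le> dim H"
  shows "\<exists>E. orthonormal E \<and> card E = k"
  using assms
proof (induction k)
  case 0
  show ?case by (rule exI[of _ "{}"]) (simp add: orthonormal_def)
next
  case (Suc k)
  then obtain E where E: "orthonormal E" "card E = k" by auto
  then have fin: "finite E" and EH: "E \<subseteq> H" by (auto simp: orthonormal_def)
  have "\<not> H \<subseteq> span E" using dim_le_card[of H E] fin E Suc.prems by auto
  then obtain f where f: "f \<in> H" "f \<noteq> 0" "\<forall>y\<in>E. ip f y = 0"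
    using orthogonal_exists[OF fin EH] by auto
  obtain c where c: "ip (scale c f) (scale c f) = 1" using normalize_exists f by blast
  let ?g = "scale c f"
  have g: "?g \<in> H" "\<forall>y\<in>E. ip ?g y = 0" using f EH by (auto simp: ip_scale_left)
  have "?g \<notin> E" using g c by auto
  moreover have "\<forall>y\<in>E. ip y ?g = 0" using g EH ip_eq_0_commute by blast
  ultimately show ?case
    using E g c by (intro exI[of _ "insert ?g E"]) (auto simp: orthonormal_def)
qed

lemma orthonormal_expand:
  assumes "orthonormal E" "H \<subseteq> span E" "f \<in> H"
  shows "f = (\<Sum>e\<in>E. scale (ip f e) e)"
proof -
  have EH: "E \<subseteq> H" and fin: "finite E" using assms by (auto simp: orthonormal_def)
  let ?g = "\<Sum>e\<in>E. scale (ip f e) e"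
  have gH: "?g \<in> H" using EH by (intro H_sum H_scale) auto
  have "ip (f - ?g) y = 0" if y: "y \<in> E" for y
  proof -
    have "ip ?g y = (\<Sum>e\<in>E. ip f e * ip e y)"
      using EH y by (subst ip_sum_left) (auto simp: ip_scale_left subset_iff)
    also have "\<dots> = (\<Sum>e\<in>E. if e = y then ip f y else 0)"
      using assms(1) y by (intro sum.cong) (auto simp: orthonormal_def)
    also have "\<dots> = ip f y" using y fin by simp
    finally show ?thesis using EH y gH assms(3) by (subst ip_diff_left) auto
  qed
  moreover have "f - ?g \<in> H" "f - ?g \<in> span E" using assms(2,3) gH H_diff by blast+
  ultimately have "ip (f - ?g) (f - ?g) = 0" using ip_span_eq_0[OF EH] by blast
  then show ?thesis using ip_self_eq_0_iff[of "f - ?g"] gH assms(3) by simp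
qed

lemma parseval:
  assumes "orthonormal E" "H \<subseteq> span E" "f \<in> H"
  shows "norm (ip f f) = (\<Sum>e\<in>E. (norm (ip f e))\<^sup>2)"
proof -
  have EH: "E \<subseteq> H" using assms by (auto simp: orthonormal_def)
  have "ip f f = ip f (\<Sum>e\<in>E. scale (ip f e) e)"
    using orthonormal_expand[OF assms] by simp
  also have "\<dots> = (\<Sum>e\<in>E. ip f e * conjugate (ip f e))"
    using EH assms(3) by (subst ip_sum_right) (auto simp: ip_scale_right subset_iff mult.commute)
  also have "\<dots> = of_real (\<Sum>e\<in>E. (norm (ip f e))\<^sup>2)"
    by (simp add: mult_conjugate)
  finally have "norm (ip f f) = norm (of_real (\<Sum>e\<in>E. (norm (ip f e))\<^sup>2) :: 'f)" by simp
  then show ?thesis by (simp only: norm_of_real) (simp add: sum_nonneg)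
qed

text \<open>\<open>0 < dim H\<close> forces finite dimension, because \<open>card\<close> of an
  infinite basis is 0. If E did not span, a nonzero vector orthogonal to it would give dim H + 1
  independent vectors in the span of dim H vectors.\<close>

lemma orthonormal_spans:
  assumes "orthonormal E" "card E = dim H" "0 < dim H"
  shows "H \<subseteq> span E"
proof (rule ccontr)
  assume n: "\<not> H \<subseteq> span E"
  have fin: "finite E" and EH: "E \<subseteq> H" using assms by (auto simp: orthonormal_def)
  obtain B where B: "B \<subseteq> H" "H \<subseteq> span B" "card B = dim H" using basis_exists by metis
  have finB: "finite B" using assms(3) B(3) card.infinite by fastforce
  obtain f where f: "f \<in> H" "f \<noteq> 0" "\<forall>y\<in>E. ip f y = 0"
    using orthogonal_exists[OF fin EH n] by auto
  have nf: "f \<notin> E" using f ip_self_eq_0_iff by auto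
  have "independent (insert f E)"
  proof (rule independent_if_scalars_zero)
    fix c x assume s: "(\<Sum>x\<in>insert f E. scale (c x) x) = 0" and x: "x \<in> insert f E"
    have ort: "ip y x = 0" if "y \<in> insert f E" "y \<noteq> x" for y
      using that x f assms(1) ip_eq_0_commute[OF f(1)] EH by (auto simp: orthonormal_def)
    have xH: "x \<in> H" and iH: "insert f E \<subseteq> H" using x f EH by auto
    have "0 = ip (\<Sum>x\<in>insert f E. scale (c x) x) x" using s xH by simp
    also have "\<dots> = (\<Sum>y\<in>insert f E. c y * ip y x)"
      using iH xH by (subst ip_sum_left) (auto intro!: sum.cong ip_scale_left simp del: insert_iff)
    also have "\<dots> = (\<Sum>y\<in>insert f E. if y = x then c x * ip x x else 0)"
      by (intro sum.cong) (auto simp: ort)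
    also have "\<dots> = c x * ip x x" using x fin by simp
    finally show "c x = 0" using f(2) x ip_self_eq_0_iff[OF xH] assms(1)
      by (auto simp: orthonormal_def)
  qed (use fin in simp)
  moreover have "insert f E \<subseteq> span B" using B f EH by auto
  ultimately have "card (insert f E) \<le> card B" using independent_span_bound[OF finB] by blast
  then show False using nf fin assms B by simp
qed

section \<open>Bessel bounds, and frames as spanning sequences\<close>

lemma span_bessel:
  assumes "set ys \<subseteq> H" "x \<in> span (set ys)"
  shows "\<exists>C\<ge>0. \<forall>f\<in>H. (norm (ip f x))\<^sup>2 \<le> C * (\<Sum>i<length ys. (norm (ip f (ys ! i)))\<^sup>2)"
    (is "?P x")
proof -
  have "x \<in> H \<and> ?P x" using assms(2)
  proof (induction rule: span_induct_alt)
    case base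
    show ?case by (intro conjI exI[of _ 0]) simp_all
  next
    case (step c y z)
    then obtain C where C: "C \<ge> 0" "\<forall>f\<in>H. (norm (ip f z))\<^sup>2 \<le> C * (\<Sum>i<length ys. (norm (ip f (ys ! i)))\<^sup>2)"
      by blast
    have yz: "y \<in> H" "z \<in> H" using step assms(1) by auto
    have "?P (scale c y + z)"
    \<comment> \<open>The constant comes from (a + b)^2 \<le> 2 a^2 + 2 b^2, with the sum S bounding
      the term of y and C S bounding the term of z.\<close>
    proof (intro exI[of _ "2 * (norm c)\<^sup>2 + 2 * C"] conjI ballI)
      fix f assume f: "f \<in> H"
      let ?S = "\<Sum>i<length ys. (norm (ip f (ys ! i)))\<^sup>2"
      obtain j where j: "j < length ys" "y = ys ! j" using step(1) by (auto simp: in_set_conv_nth)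
      have yS: "(norm (ip f y))\<^sup>2 \<le> ?S"
        unfolding j(2) by (rule member_le_sum) (use j in auto)
      have "norm (ip f (scale c y + z)) \<le> norm c * norm (ip f y) + norm (ip f z)"
        using f yz norm_triangle_ineq[of "conjugate c * ip f y" "ip f z"]
        by (simp add: ip_add_right ip_scale_right norm_mult)
      then have "(norm (ip f (scale c y + z)))\<^sup>2 \<le> (norm c * norm (ip f y) + norm (ip f z))\<^sup>2"
        by (simp add: power_mono)
      also have "\<dots> \<le> 2 * (norm c)\<^sup>2 * (norm (ip f y))\<^sup>2 + 2 * (norm (ip f z))\<^sup>2"
        using sum_squares_bound[of "norm c * norm (ip f y)" "norm (ip f z)"]
        by (simp add: power2_sum power_mult_distrib)
      also have "\<dots> \<le> 2 * (norm c)\<^sup>2 * ?S + 2 * (C * ?S)"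
        using C(2) f yS by (intro add_mono mult_left_mono) auto
      finally show "(norm (ip f (scale c y + z)))\<^sup>2 \<le> (2 * (norm c)\<^sup>2 + 2 * C) * ?S"
        by (simp add: algebra_simps)
    qed (use C in simp)
    then show ?case using yz by simp
  qed
  then show ?thesis by blast
qed

lemma span_bessel_sum:
  assumes "set ys \<subseteq> H" "set xs \<subseteq> span (set ys)"
  shows "\<exists>C>0. \<forall>f\<in>H. (\<Sum>i<length xs. (norm (ip f (xs ! i)))\<^sup>2)
    \<le> C * (\<Sum>i<length ys. (norm (ip f (ys ! i)))\<^sup>2)"
proof -
  have "\<forall>i<length xs. \<exists>C\<ge>0. \<forall>f\<in>H. (norm (ip f (xs ! i)))\<^sup>2 \<le> C * (\<Sum>i<length ys. (norm (ip f (ys ! i)))\<^sup>2)"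
    using span_bessel[OF assms(1)] assms(2) nth_mem by blast
  then obtain C where C: "\<And>i. i < length xs \<Longrightarrow> C i \<ge> 0"
    "\<And>i f. i < length xs \<Longrightarrow> f \<in> H \<Longrightarrow> (norm (ip f (xs ! i)))\<^sup>2 \<le> C i * (\<Sum>i<length ys. (norm (ip f (ys ! i)))\<^sup>2)"
    by metis
  show ?thesis
  proof (intro exI[of _ "1 + (\<Sum>i<length xs. C i)"] conjI ballI)
    show "0 < 1 + (\<Sum>i<length xs. C i)"
      using sum_nonneg[of "{..<length xs}" C] C(1) by fastforce
    fix f assume f: "f \<in> H"
    let ?S = "\<Sum>i<length ys. (norm (ip f (ys ! i)))\<^sup>2"
    have "(\<Sum>i<length xs. (norm (ip f (xs ! i)))\<^sup>2) \<le> (\<Sum>i<length xs. C i * ?S)"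
      by (intro sum_mono) (use C(2) f in auto)
    also have "\<dots> = (\<Sum>i<length xs. C i) * ?S" by (simp add: sum_distrib_right)
    also have "\<dots> \<le> (1 + (\<Sum>i<length xs. C i)) * ?S"
      by (intro mult_right_mono sum_nonneg) auto
    finally show "(\<Sum>i<length xs. (norm (ip f (xs ! i)))\<^sup>2) \<le> (1 + (\<Sum>i<length xs. C i)) * ?S" .
  qed
qed

text \<open>A nonzero vector orthogonal to the whole sequence would violate the lower frame
  bound.\<close>

lemma frame_imp_spans:
  assumes "finite_frame ip H \<phi>"
  shows "H \<subseteq> span (set \<phi>)"
proof (rule ccontr)
  assume "\<not> H \<subseteq> span (set \<phi>)"
  then obtain f where f: "f \<in> H" "f \<noteq> 0" "\<forall>y\<in>set \<phi>. ip f y = 0"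
    using orthogonal_exists[of "set \<phi>"] assms by (auto simp: finite_frame_def)
  from assms obtain A where "0 < A"
    "A * norm (ip f f) \<le> (\<Sum>i<length \<phi>. (norm (ip f (\<phi> ! i)))\<^sup>2)"
    using f(1) by (auto simp: finite_frame_def)
  moreover have "(\<Sum>i<length \<phi>. (norm (ip f (\<phi> ! i)))\<^sup>2) = 0"
    using f(3) by simp
  ultimately have "norm (ip f f) \<le> 0" by (simp add: mult_le_0_iff)
  then show False using f(1,2) ip_self_eq_0_iff by simp
qed

text \<open>The sequence is compared with an orthonormal basis es: each lies in the span of the
  other, and by Parseval the sum over es is the squared norm. The two Bessel bounds thus become the
  two frame inequalities.\<close>

lemma spans_imp_frame:
  assumes "set \<phi> \<subseteq> H" "H \<subseteq> span (set \<phi>)" "0 < dim H"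
  shows "finite_frame ip H \<phi>"
proof -
  obtain E where E: "orthonormal E" "card E = dim H" using orthonormal_extend by blast
  have spE: "H \<subseteq> span E" by (rule orthonormal_spans[OF E assms(3)])
  have EH: "E \<subseteq> H" and finE: "finite E" using E by (auto simp: orthonormal_def)
  obtain es where es: "set es = E" "distinct es" using finite_distinct_list[OF finE] by auto
  have nrm: "norm (ip f f) = (\<Sum>i<length es. (norm (ip f (es ! i)))\<^sup>2)" if "f \<in> H" for f
  proof -
    have "(\<Sum>e\<in>E. (norm (ip f e))\<^sup>2) = (\<Sum>i<length es. (norm (ip f (es ! i)))\<^sup>2)"
      using es by (intro sum.reindex_bij_betw[symmetric]) (auto intro: bij_betw_nth)
    then show ?thesis using parseval[OF E(1) spE that] by simp
  qed
  obtain C where C: "C > 0" "\<And>f. f \<in> H \<Longrightarrow> norm (ip f f) \<le> C * (\<Sum>i<length \<phi>. (norm (ip f (\<phi> ! i)))\<^sup>2)"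
    using span_bessel_sum[OF assms(1), of es] es(1) order_trans[OF EH assms(2)] nrm by auto
  obtain B where B: "B > 0" "\<And>f. f \<in> H \<Longrightarrow> (\<Sum>i<length \<phi>. (norm (ip f (\<phi> ! i)))\<^sup>2) \<le> B * norm (ip f f)"
    using span_bessel_sum[of es \<phi>] es(1) EH order_trans[OF assms(1) spE] nrm by auto
  \<comment> \<open>The maximum secures that the lower constant does not exceed the upper one, as
    \<open>finite_frame\<close> demands.\<close>
  have "0 < 1 / C" "1 / C \<le> max (1 / C) B" using C by auto
  moreover have "1 / C * norm (ip f f) \<le> (\<Sum>i<length \<phi>. (norm (ip f (\<phi> ! i)))\<^sup>2)" if "f \<in> H" for f
    using C(1) C(2)[OF that] by (simp add: field_simps)
  moreover have "(\<Sum>i<length \<phi>. (norm (ip f (\<phi> ! i)))\<^sup>2) \<le> max (1 / C) B * norm (ip f f)" if "f \<in> H" for f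
    using B(2)[OF that] by (rule order_trans) (simp add: mult_right_mono)
  ultimately show ?thesis using assms(1) unfolding finite_frame_def by blast
qed

text \<open>Independence is stated for an indexed family, since frame vectors may repeat. It rules
  repetitions out: if f i = f j, the coefficients 1 and -1 give a vanishing combination.\<close>

lemma independent_family_card_le_dim:
  assumes "finite I" "f ` I \<subseteq> H" "0 < dim H"
    and ind: "\<And>c. (\<Sum>i\<in>I. scale (c i) (f i)) = 0 \<Longrightarrow> \<forall>i\<in>I. c i = 0"
  shows "card I \<le> dim H"
proof -
  have inj: "inj_on f I"
  proof (rule inj_onI, rule ccontr)
    fix i j assume ij: "i \<in> I" "j \<in> I" "f i = f j" "i \<noteq> j"
    let ?c = "\<lambda>k. if k = i then 1 else if k = j then -1 else 0"
    have "(\<Sum>k\<in>I. scale (?c k) (f k)) = (\<Sum>k\<in>I. (if k = i then f i else 0) - (if k = j then f j else 0))"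
      using ij by (intro sum.cong) auto
    also have "\<dots> = 0" using ij assms(1) by (simp add: sum_subtractf)
    finally show False using ind[of ?c] ij(1) by auto
  qed
  have "independent (f ` I)"
  proof (rule independent_if_scalars_zero)
    fix c x assume s: "(\<Sum>x\<in>f ` I. scale (c x) x) = 0" and "x \<in> f ` I"
    then show "c x = 0" using ind[of "\<lambda>i. c (f i)"] by (auto simp: sum.reindex[OF inj])
  qed (use assms in simp)
  moreover obtain B where B: "B \<subseteq> H" "H \<subseteq> span B" "card B = dim H" using basis_exists by metis
  moreover have "finite B" using assms(3) B(3) card.infinite by fastforce
  ultimately have "card (f ` I) \<le> card B"
    using independent_span_bound[of B "f ` I"] assms(2) by blast
  then show ?thesis using B card_image[OF inj] by simp
qed

end

section \<open>Trees\<close>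

text \<open>
  A tree on \<open>{0, \<dots>, n - 1}\<close> with root \<open>0\<close> is encoded by its parent function, whose value at \<open>0\<close> is
  irrelevant.
\<close>

definition tree_adj :: "(nat \<Rightarrow> nat) \<Rightarrow> nat \<Rightarrow> nat \<Rightarrow> bool" where
  "tree_adj p i j \<longleftrightarrow> 0 < i \<and> p i = j \<or> 0 < j \<and> p j = i"

lemma pawalk_verts_snoc: "pcas a q b \<Longrightarrow> pawalk_verts a (q @ [(b, w)]) = pawalk_verts a q @ [w]"
  by (induction a q b rule: pcas.induct) auto

lemma undirected_tree_sym:
  "undirected_tree T \<Longrightarrow> (u, v) \<in> parcs T \<Longrightarrow> (v, u) \<in> parcs T"
  by (auto simp: undirected_tree_def pair_graph_def pair_pseudo_graph_def pair_sym_digraph_def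
      pair_sym_digraph_axioms_def symmetric_def dest: symD)

text \<open>Two different neighbours of w in S, joined by a path inside S, would close a cycle
  through w. The path is nonempty, so this cycle has length at least 3.\<close>

lemma undirected_tree_edge_unique:
  assumes T: "undirected_tree T"
    and S: "\<And>a b. a \<in> S \<Longrightarrow> b \<in> S \<Longrightarrow>
      \<exists>q. pre_digraph.apath (with_proj T) a q b \<and> set (pawalk_verts a q) \<subseteq> S"
    and w: "w \<notin> S" and a: "a \<in> S" "(w, a) \<in> parcs T" and b: "b \<in> S" "(w, b) \<in> parcs T"
  shows "a = b"
proof (rule ccontr)
  assume ab: "a \<noteq> b"
  interpret pair_graph T using T by (simp add: undirected_tree_def)
  obtain q where q: "apath a q b" "set (pawalk_verts a q) \<subseteq> S" using S a b by blast
  have bw: "(b, w) \<in> parcs T" using b(2) undirected_tree_sym[OF T] by blast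
  let ?p = "(w, a) # q @ [(b, w)]"
  have aw: "awalk a q b" and dist: "distinct (pawalk_verts a q)" using q by (auto simp: apath_def)
  have pc: "pcas a q b" using aw by (auto simp: awalk_def)
  have "awalk a (q @ [(b, w)]) w"
    by (rule awalk_appendI[OF aw]) (use bw in \<open>auto simp: awalk_simps in_arcsD2\<close>)
  then have "awalk w ?p w" using a(2) aw by (simp add: awalk_Cons_iff)
  moreover have "distinct (tl (pawalk_verts w ?p))"
    using dist q(2) w by (auto simp: pawalk_verts_snoc[OF pc])
  ultimately have "cycle ?p" by (auto simp: cycle_def)
  moreover have "q \<noteq> []" using pc ab by auto
  then have "3 \<le> length ?p" by (cases q) auto
  ultimately show False using T by (auto simp: undirected_tree_def)
qed

text \<open>The list is grown one vertex at a time. Paths inside the current vertex set are carried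
  through the induction, because they make the earlier neighbour of each new vertex unique.\<close>

lemma undirected_tree_enum:
  assumes T: "undirected_tree T" and k: "1 \<le> k" "k \<le> card (pverts T)"
  shows "\<exists>xs. length xs = k \<and> distinct xs \<and> set xs \<subseteq> pverts T \<and>
    (\<forall>a\<in>set xs. \<forall>b\<in>set xs.
      \<exists>q. pre_digraph.apath (with_proj T) a q b \<and> set (pawalk_verts a q) \<subseteq> set xs) \<and>
    (\<forall>i. 0 < i \<and> i < k \<longrightarrow> (\<exists>!j. j < i \<and> (xs ! i, xs ! j) \<in> parcs T))"
  using k
proof (induction k rule: dec_induct)
  case base
  interpret pair_graph T using T by (simp add: undirected_tree_def)
  obtain r where "r \<in> pverts T" using base by (metis card.empty ex_in_conv not_one_le_zero)
  then show ?case
    by (intro exI[of _ "[r]"]) (auto intro!: exI[of _ "[]"] simp: apath_simps)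
next
  case (step k)
  interpret pair_graph T using T by (simp add: undirected_tree_def)
  note symD = undirected_tree_sym[OF T]
  obtain xs where xs: "length xs = k" "distinct xs" "set xs \<subseteq> pverts T"
    and con: "\<And>a b. a \<in> set xs \<Longrightarrow> b \<in> set xs \<Longrightarrow> \<exists>q. apath a q b \<and> set (pawalk_verts a q) \<subseteq> set xs"
    and par: "\<And>i. 0 < i \<Longrightarrow> i < k \<Longrightarrow> \<exists>!j. j < i \<and> (xs ! i, xs ! j) \<in> parcs T"
    using step by auto
  have "card (set xs) < card (pverts T)" using xs step by (simp add: distinct_card)
  then obtain v where v: "v \<in> pverts T" "v \<notin> set xs"
    using card_mono[of "set xs" "pverts T"] by (metis List.finite_set not_less subsetI)
  obtain u where u: "u \<in> set xs" using step xs by (cases xs) auto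
  have "u \<rightarrow>\<^sup>*\<^bsub>with_proj T\<^esub> v"
    using T u v xs reachable_mk_symmetric_eq[OF pair_sym_arcs]
    by (auto simp: undirected_tree_def connected_def strongly_connected_def)
  \<comment> \<open>On the way from u in the list to v outside it, some arc leaves the list; its
    head w is the vertex to append.\<close>
  then have "v \<in> set xs \<or> (\<exists>a w. a \<in> set xs \<and> w \<notin> set xs \<and> (a, w) \<in> parcs T)"
    by (induction rule: reachable_induct) (use u in auto)
  with v obtain a w where aw: "a \<in> set xs" "w \<notin> set xs" "(a, w) \<in> parcs T" by blast
  have wa: "(w, a) \<in> parcs T" using symD aw by blast
  have uniq: "b = a" if "b \<in> set xs" "(w, b) \<in> parcs T" for b
    by (rule undirected_tree_edge_unique[OF T con aw(2) that aw(1) wa])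
  let ?xs = "xs @ [w]"
  have "\<exists>q. apath c q d \<and> set (pawalk_verts c q) \<subseteq> set ?xs" if cd: "c \<in> set ?xs" "d \<in> set ?xs" for c d
  proof -
    consider "c \<in> set xs" "d \<in> set xs" | "c = w" "d = w" | "c = w" "d \<in> set xs" | "c \<in> set xs" "d = w"
      using cd by auto
    then show ?thesis
    proof cases
      case 1 then show ?thesis using con[of c d] by force
    next
      case 2
      then show ?thesis using aw in_arcsD2 by (intro exI[of _ "[]"]) (auto simp: apath_simps)
    next
      case 3
      obtain q where q: "apath a q d" "set (pawalk_verts a q) \<subseteq> set xs" using con[OF aw(1) 3(2)] by auto
      then show ?thesis using 3 wa aw(2)
        by (intro exI[of _ "(w, a) # q"]) (auto simp: apath_simps)
    next
      case 4
      obtain q where q: "apath c q a" "set (pawalk_verts c q) \<subseteq> set xs" using con[OF 4(1) aw(1)] by auto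
      have A: "awalk c q a" and D: "distinct (pawalk_verts c q)" using q by (auto simp: apath_def)
      have pc: "pcas c q a" using A by (auto simp: awalk_def)
      have "awalk c (q @ [(a, w)]) w"
        by (rule awalk_appendI[OF A]) (use aw in \<open>auto simp: awalk_simps in_arcsD2\<close>)
      then show ?thesis using q D aw 4 pawalk_verts_snoc[OF pc, of w]
        by (intro exI[of _ "q @ [(a, w)]"]) (auto simp: apath_def)
    qed
  qed
  moreover have "\<exists>!j. j < i \<and> (?xs ! i, ?xs ! j) \<in> parcs T" if i: "0 < i" "i < Suc k" for i
  proof (cases "i < k")
    case True
    have "j < i \<and> (?xs ! i, ?xs ! j) \<in> parcs T \<longleftrightarrow> j < i \<and> (xs ! i, xs ! j) \<in> parcs T" for j
      using True xs by (auto simp: nth_append)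
    then show ?thesis using par[OF i(1) True] by simp
  next
    case False
    then have ik: "i = k" using i by simp
    obtain j where j: "j < k" "xs ! j = a" using aw(1) xs by (auto simp: in_set_conv_nth)
    show ?thesis
    proof (rule ex1I[of _ j])
      show "j < i \<and> (?xs ! i, ?xs ! j) \<in> parcs T" using j xs ik wa by (simp add: nth_append)
      fix j' assume "j' < i \<and> (?xs ! i, ?xs ! j') \<in> parcs T"
      then have j': "j' < k" "(w, xs ! j') \<in> parcs T" using xs ik by (auto simp: nth_append)
      then have "xs ! j' = a" using uniq xs by auto
      then show "j' = j" using j j' xs by (metis nth_eq_iff_index_eq)
    qed
  qed
  moreover have "length ?xs = Suc k" "distinct ?xs" "set ?xs \<subseteq> pverts T"
    using xs aw in_arcsD2 by auto
  ultimately show ?case by (intro exI[of _ ?xs]) blast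
qed

text \<open>Numbering the vertices in the order of enumeration puts each parent before its children,
  so induction along the tree becomes induction on natural numbers.\<close>

lemma undirected_tree_parent:
  assumes T: "undirected_tree T" and n: "card (pverts T) = n" "1 \<le> n"
  obtains t :: "nat \<Rightarrow> 'a" and p
  where "bij_betw t {..<n} (pverts T)" "\<And>i. 0 < i \<Longrightarrow> p i < i"
    "\<And>i j. i < n \<Longrightarrow> j < n \<Longrightarrow> (t i, t j) \<in> parcs T \<longleftrightarrow> tree_adj p i j"
proof -
  interpret pair_graph T using T by (simp add: undirected_tree_def)
  note symD = undirected_tree_sym[OF T]
  obtain xs where xs: "length xs = n" "distinct xs" "set xs \<subseteq> pverts T"
    and par: "\<And>i. 0 < i \<Longrightarrow> i < n \<Longrightarrow> \<exists>!j. j < i \<and> (xs ! i, xs ! j) \<in> parcs T"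
    using undirected_tree_enum[OF T n(2)] n by auto
  \<comment> \<open>The value 0 from n onwards makes \<open>p i < i\<close> hold for all positive i,
    not only for the vertices.\<close>
  define p where "p i = (if i < n then THE j. j < i \<and> (xs ! i, xs ! j) \<in> parcs T else 0)" for i
  have p: "p i < i" "(xs ! i, xs ! p i) \<in> parcs T" if "0 < i" "i < n" for i
    using theI'[OF par[OF that]] that by (auto simp: p_def)
  have p_eq: "p i = j" if "i < n" "j < i" "(xs ! i, xs ! j) \<in> parcs T" for i j
    using par[of i] p[of i] that by (metis gr_implies_not0 neq0_conv)
  show ?thesis
  proof (rule that[of "(!) xs" p])
    have "set xs = pverts T"
      using xs n finite_verts by (intro card_subset_eq) (auto simp: distinct_card)
    then show "bij_betw ((!) xs) {..<n} (pverts T)"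
      using xs by (metis bij_betw_nth)
    show "p i < i" if "0 < i" for i
      using that p(1)[of i] by (cases "i < n") (auto simp: p_def)
    fix i j assume ij: "i < n" "j < n"
    show "(xs ! i, xs ! j) \<in> parcs T \<longleftrightarrow> tree_adj p i j"
    proof
      assume e: "(xs ! i, xs ! j) \<in> parcs T"
      then have "i \<noteq> j" using no_loops by fastforce
      then consider "j < i" | "i < j" by linarith
      then show "tree_adj p i j"
        using p_eq[of i j] p_eq[of j i] ij e symD by cases (auto simp: tree_adj_def)
    next
      assume "tree_adj p i j"
      then show "(xs ! i, xs ! j) \<in> parcs T"
        using p ij symD by (auto simp: tree_adj_def)
    qed
  qed
qed

section \<open>The lower bound\<close>

text \<open>Adjacency in the product of T and K_m in coordinates: the first component numbers a
  vertex of T, the second a vertex of K_m.\<close>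

definition prod_adj :: "(nat \<Rightarrow> nat) \<Rightarrow> nat \<times> nat \<Rightarrow> nat \<times> nat \<Rightarrow> bool" where
  "prod_adj p x y \<longleftrightarrow> fst x = fst y \<and> snd x \<noteq> snd y \<or> snd x = snd y \<and> tree_adj p (fst x) (fst y)"

context rc_inner_product_space
begin

lemma nonroot_independent:
  fixes F :: "nat \<times> nat \<Rightarrow> 'v" and p :: "nat \<Rightarrow> nat"
  assumes p: "\<And>i. 0 < i \<Longrightarrow> p i < i"
    and FH: "\<And>x. x \<in> {..<n} \<times> {..<m} \<Longrightarrow> F x \<in> H"
    and adj: "\<And>x y. x \<in> {..<n} \<times> {..<m} \<Longrightarrow> y \<in> {..<n} \<times> {..<m} \<Longrightarrow> x \<noteq> y \<Longrightarrow>
      ip (F x) (F y) \<noteq> 0 \<longleftrightarrow> prod_adj p x y"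
    and zero: "(\<Sum>x\<in>{1..<n} \<times> {..<m}. scale (c x) (F x)) = 0"
  shows "\<forall>x\<in>{1..<n} \<times> {..<m}. c x = 0"
proof -
  let ?X = "{1..<n} \<times> {..<m}"
  have X: "x \<in> {..<n} \<times> {..<m}" if "x \<in> ?X" for x using that by auto
  have "\<forall>v<m. c (i, v) = 0" if "0 < i" "i < n" for i
    using that
  proof (induction i rule: less_induct)
    case (less i)
    \<comment> \<open>D is the branch at i: i together with its descendants.\<close>
    define D where "D = {j. (j, i) \<in> {(a, p a) |a. 0 < a}\<^sup>*}"
    have iD: "i \<in> D" by (simp add: D_def)
    have D_down: "j \<in> D \<Longrightarrow> j \<noteq> i \<Longrightarrow> p j \<in> D" for j
      by (auto simp: D_def elim: converse_rtranclE)
    have D_up: "0 < j \<Longrightarrow> p j \<in> D \<Longrightarrow> j \<in> D" for j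
      by (auto simp: D_def intro: converse_rtrancl_into_rtrancl)
    have D_ge: "i \<le> j" if "j \<in> D" for j
      using that unfolding D_def mem_Collect_eq
      by (induction rule: converse_rtrancl_induct) (use p in \<open>auto dest: less_imp_le intro: order_trans\<close>)
    let ?A = "{x \<in> ?X. fst x \<in> D}" and ?B = "{x \<in> ?X. fst x \<notin> D}"
    let ?y = "\<Sum>x\<in>?A. scale (c x) (F x)" and ?z = "\<Sum>x\<in>?B. scale (c x) (F x)"
    have yH: "?y \<in> H" and zH: "?z \<in> H" by (force intro!: H_sum H_scale FH)+
    have "?y + ?z = (\<Sum>x\<in>?X. scale (c x) (F x))"
      by (subst sum.union_disjoint[symmetric]) (auto intro: sum.cong)
    then have sum0: "?y + ?z = 0" using zero by simp
    \<comment> \<open>The coefficient has to stay in: the vectors need not be orthogonal when x'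
      lies over p i. If p i is not the root, c vanishes there by the induction hypothesis; the root
      copy does not occur in ?B.\<close>
    have orth: "conjugate (c x') * ip (F x) (F x') = 0" if x: "x \<in> ?A" and x': "x' \<in> ?B" for x x'
    proof (rule ccontr)
      assume "\<not> ?thesis"
      then have ne: "ip (F x) (F x') \<noteq> 0" and c: "c x' \<noteq> 0" by auto
      have "x \<noteq> x'" using x x' by auto
      then have "prod_adj p x x'" using adj ne X x x' by blast
      then have "p (fst x) = fst x' \<or> p (fst x') = fst x"
        using x x' by (auto simp: prod_adj_def tree_adj_def)
      then show False
      proof
        assume e: "p (fst x) = fst x'"
        then have "fst x = i" using D_down[of "fst x"] x x' by auto
        then have "fst x' < i" using e p[of i] less.prems by auto
        then show False using less.IH[of "fst x'"] x' c less.prems by auto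
      next
        assume "p (fst x') = fst x"
        then show False using D_up[of "fst x'"] x x' by auto
      qed
    qed
    have "ip ?y ?z = (\<Sum>x\<in>?A. c x * ip (F x) ?z)"
      using zH FH X by (subst ip_sum_left) (auto simp: ip_scale_left)
    also have "\<dots> = (\<Sum>x\<in>?A. c x * (\<Sum>x'\<in>?B. conjugate (c x') * ip (F x) (F x')))"
    proof (rule sum.cong[OF refl])
      fix x assume "x \<in> ?A"
      then have "F x \<in> H" using FH X by auto
      then show "c x * ip (F x) ?z = c x * (\<Sum>x'\<in>?B. conjugate (c x') * ip (F x) (F x'))"
        using FH X by (subst ip_sum_right) (auto simp: ip_scale_right)
    qed
    also have "\<dots> = 0"
    proof (rule sum.neutral, rule ballI)
      fix x assume "x \<in> ?A"
      then have "(\<Sum>x'\<in>?B. conjugate (c x') * ip (F x) (F x')) = 0"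
        by (intro sum.neutral ballI orth)
      then show "c x * (\<Sum>x'\<in>?B. conjugate (c x') * ip (F x) (F x')) = 0" by (simp only: mult_zero_right)
    qed
    \<comment> \<open>As ?y + ?z = 0 and ?y is orthogonal to ?z, it is orthogonal to itself.\<close>
    finally have "ip ?y ?y = 0"
      using ip_add_right[OF yH zH yH] sum0 yH by simp
    then have y0: "?y = 0" using ip_self_eq_0_iff yH by blast
    show ?case
    proof (intro allI impI)
      fix v assume v: "v < m"
      \<comment> \<open>The test vector lies over the parent of i, possibly in the root copy. Its
        only neighbour in the branch is (i, v), which isolates c (i, v).\<close>
      let ?w = "(p i, v)"
      have pi: "p i < i" "p i \<notin> D" using p[of i] less.prems D_ge[of "p i"] by auto
      have w: "?w \<in> {..<n} \<times> {..<m}" using pi less.prems v by auto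
      have iv: "(i, v) \<in> ?A" using less.prems v iD by auto
      have "x = (i, v)" if x: "x \<in> ?A" and ne: "ip (F x) (F ?w) \<noteq> 0" for x
      proof -
        have "x \<noteq> ?w" using x pi by auto
        then have "prod_adj p x ?w" using adj ne X x w by blast
        then have sn: "snd x = v" and "p (fst x) = p i \<or> 0 < p i \<and> p (p i) = fst x"
          using x pi by (auto simp: prod_adj_def tree_adj_def)
        moreover have "\<not> (0 < p i \<and> p (p i) = fst x)"
          using p[of "p i"] D_ge[of "fst x"] x pi by auto
        ultimately have "p (fst x) = p i" by blast
        then have "fst x = i" using D_down[of "fst x"] x pi by auto
        with sn show ?thesis by (simp add: prod_eq_iff)
      qed
      then have eq: "(\<Sum>x\<in>?A. c x * ip (F x) (F ?w)) = (\<Sum>x\<in>?A. if x = (i, v) then c (i, v) * ip (F (i, v)) (F ?w) else 0)"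
        by (intro sum.cong) auto
      have "0 = ip ?y (F ?w)" using y0 FH w by simp
      also have "\<dots> = (\<Sum>x\<in>?A. c x * ip (F x) (F ?w))"
        using FH X w by (subst ip_sum_left) (auto simp: ip_scale_left)
      also have "\<dots> = c (i, v) * ip (F (i, v)) (F ?w)" unfolding eq using iv by simp
      finally have "c (i, v) * ip (F (i, v)) (F ?w) = 0" by simp
      moreover have "ip (F (i, v)) (F ?w) \<noteq> 0"
        using adj[of "(i, v)" ?w] w iv pi less.prems by (auto simp: prod_adj_def tree_adj_def)
      ultimately show "c (i, v) = 0" by simp
    qed
  qed
  then show ?thesis by auto
qed

end

section \<open>The construction\<close>

text \<open>
  With \<open>J\<close> the all-ones matrix of size \<open>m\<close>, the inverse of \<open>P = I + J\<close> is \<open>I - J / (m + 1)\<close>.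
  In the block of a non-root vertex \<open>t\<close>, the vertex \<open>(p t, v)\<close> gets the vector \<open>P e\<^sub>v\<close> and \<open>(t, v)\<close> gets
  \<open>P\<^sup>-\<^sup>1 e\<^sub>v\<close>, so that the edge between two copies of the complete graph is a perfect matching.
  The root block \<open>t = 0\<close> only serves to raise the dimension.
\<close>

definition frame_coeff :: "(nat \<Rightarrow> nat) \<Rightarrow> nat \<Rightarrow> nat \<times> nat \<Rightarrow> nat \<times> nat \<Rightarrow> real" where
  "frame_coeff p m x i =
     (if fst i \<noteq> 0 \<and> p (fst i) = fst x then 1 + of_bool (snd i = snd x)
      else if fst i = fst x then of_bool (snd i = snd x) - (if fst x = 0 then 0 else 1 / (real m + 1))
      else 0)"

text \<open>Labels for an orthonormal basis of the space: m coordinates for each non-root block and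
  k for the root block.\<close>

definition basis_index :: "nat \<Rightarrow> nat \<Rightarrow> nat \<Rightarrow> (nat \<times> nat) set" where
  "basis_index n m k = {1..<n} \<times> {..<m} \<union> {0} \<times> {..<k}"

lemma finite_basis_index [simp]: "finite (basis_index n m k)"
  by (simp add: basis_index_def)

lemma card_basis_index: "card (basis_index n m k) = (n - 1) * m + k"
  unfolding basis_index_def by (subst card_Un_disjoint) (auto simp: card_cartesian_product)

lemma sum_basis_index:
  "sum f (basis_index n m k) = (\<Sum>t\<in>{1..<n}. \<Sum>u<m. f (t, u)) + (\<Sum>u<k. f (0, u))"
proof -
  have "sum f (basis_index n m k) = sum f ({1..<n} \<times> {..<m}) + sum f ({0} \<times> {..<k})"
    unfolding basis_index_def by (rule sum.union_disjoint) auto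
  also have "sum f ({0} \<times> {..<k}) = (\<Sum>u<k. f (0, u))"
    by (simp add: sum.cartesian_product' split_def)
  finally show ?thesis by (simp add: sum.cartesian_product')
qed

text \<open>Both P e_v and P^-1 e_v are e_v plus a multiple \<alpha> of the all-ones vector, with
  \<alpha> = 1 and \<alpha> = -1/(m + 1). One formula thus yields the entries of P^2, P^-2 and P
  P^-1.\<close>

lemma sum_shifted_indicators:
  fixes \<alpha> \<beta> :: real
  assumes "v < m" "w < m"
  shows "(\<Sum>u<m. (\<alpha> + of_bool (u = v)) * (\<beta> + of_bool (u = w))) =
    real m * \<alpha> * \<beta> + \<alpha> + \<beta> + of_bool (v = w)"
proof -
  have "(\<Sum>u<m. (\<alpha> + of_bool (u = v)) * (\<beta> + of_bool (u = w))) =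
    (\<Sum>u<m. \<alpha> * \<beta> + (if u = v then \<beta> else 0) + (if u = w then \<alpha> else 0)
      + (if u = v then of_bool (v = w) else 0))"
    by (intro sum.cong) (auto simp: algebra_simps)
  also have "\<dots> = real m * \<alpha> * \<beta> + \<alpha> + \<beta> + of_bool (v = w)"
    using assms by (simp add: sum.distrib)
  finally show ?thesis .
qed

text \<open>The values are the entries of P^2 = I + (m + 2) J, of P^-2 = I - (m + 2)/(m + 1)^2 J and
  of P P^-1 = I, when t is a child of both r and s, equals both, or is a child of one and equals the
  other.\<close>

lemma frame_coeff_block:
  assumes p: "\<And>i. 0 < i \<Longrightarrow> p i < i" and t: "0 < t" and vw: "v < m" "w < m"
  shows "(\<Sum>u<m. frame_coeff p m (r, v) (t, u) * frame_coeff p m (s, w) (t, u)) =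
    (if p t = r \<and> p t = s then real m + 2 + of_bool (v = w)
     else if t = r \<and> t = s then of_bool (v = w) - (real m + 2) / (real m + 1)\<^sup>2
     else if p t = r \<and> t = s \<or> t = r \<and> p t = s then of_bool (v = w)
     else 0)"
proof -
  let ?c = "- (1 / (real m + 1))"
  have ptt: "p t \<noteq> t" using p[OF t] by simp
  have form: "frame_coeff p m (q, x) (t, u) =
      (if p t = q then 1 + of_bool (u = x) else if t = q then ?c + of_bool (u = x) else 0)" for q x u
    using t ptt by (auto simp: frame_coeff_def)
  have cc: "real m * ?c * ?c + ?c + ?c = - ((real m + 2) / (real m + 1)\<^sup>2)"
  proof -
    \<comment> \<open>The relation m q = 1 - q reduces both sides to polynomials in q.\<close>
    define q where "q = 1 / (real m + 1)"
    have mq: "real m * q = 1 - q" by (simp add: q_def field_simps)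
    have "(real m + 2) / (real m + 1)\<^sup>2 = (real m * q) * q + 2 * q * q"
      by (simp add: q_def power2_eq_square add_divide_distrib)
    also have "\<dots> = q + q * q" unfolding mq by (simp add: algebra_simps)
    finally have e: "(real m + 2) / (real m + 1)\<^sup>2 = q + q * q" .
    have "real m * ?c * ?c + ?c + ?c = (real m * q) * q - 2 * q" by (simp add: q_def)
    also have "\<dots> = - (q + q * q)" unfolding mq by (simp add: algebra_simps)
    finally show ?thesis unfolding e .
  qed
  have c1: "real m * 1 * ?c + 1 + ?c = 0" "real m * ?c * 1 + ?c + 1 = 0"
    by (simp_all add: field_simps)
  consider "p t = r" "p t = s" | "t = r" "t = s" | "p t = r" "t = s" | "t = r" "p t = s"
    | "p t \<noteq> r" "t \<noteq> r" | "p t \<noteq> s" "t \<noteq> s" by auto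
  then show ?thesis
  proof cases
    case 1
    then show ?thesis unfolding form using sum_shifted_indicators[OF vw, of 1 1] by simp
  next
    case 2
    have "(\<Sum>u<m. frame_coeff p m (r, v) (t, u) * frame_coeff p m (s, w) (t, u)) =
        (\<Sum>u<m. (?c + of_bool (u = v)) * (?c + of_bool (u = w)))"
      unfolding form using 2 ptt by (intro sum.cong) auto
    also have "\<dots> = of_bool (v = w) - (real m + 2) / (real m + 1)\<^sup>2"
      unfolding sum_shifted_indicators[OF vw] cc by simp
    finally show ?thesis using 2 ptt by auto
  next
    case 3
    have "(\<Sum>u<m. frame_coeff p m (r, v) (t, u) * frame_coeff p m (s, w) (t, u)) =
        (\<Sum>u<m. (1 + of_bool (u = v)) * (?c + of_bool (u = w)))"
      unfolding form using 3 ptt by (intro sum.cong) auto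
    also have "\<dots> = of_bool (v = w)"
      unfolding sum_shifted_indicators[OF vw] c1 by simp
    finally show ?thesis using 3 ptt by auto
  next
    case 4
    have "(\<Sum>u<m. frame_coeff p m (r, v) (t, u) * frame_coeff p m (s, w) (t, u)) =
        (\<Sum>u<m. (?c + of_bool (u = v)) * (1 + of_bool (u = w)))"
      unfolding form using 4 ptt by (intro sum.cong) auto
    also have "\<dots> = of_bool (v = w)"
      unfolding sum_shifted_indicators[OF vw] c1 by simp
    finally show ?thesis using 4 ptt by auto
  qed (auto simp: form)
qed

text \<open>Inside one copy, each child block adds m + 2, and the own block of a non-root vertex
  subtracts a positive number below m + 2, so the total is never 0; the root has at least one child.
  Between different copies only P P^-1 = I occurs, which gives the matching along tree
  edges.\<close>

lemma frame_coeff_gram: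
  assumes p: "\<And>i. 0 < i \<Longrightarrow> p i < i" and n: "2 \<le> n" and k: "k \<le> m"
    and x: "x \<in> {..<n} \<times> {..<m}" and y: "y \<in> {..<n} \<times> {..<m}" and ne: "x \<noteq> y"
  shows "(\<Sum>i\<in>basis_index n m k. frame_coeff p m x i * frame_coeff p m y i) \<noteq> 0 \<longleftrightarrow> prod_adj p x y"
proof -
  obtain r v s w where xy: "x = (r, v)" "y = (s, w)" by (cases x, cases y)
  have b: "r < n" "v < m" "s < n" "w < m" using x y xy by auto
  let ?a = "frame_coeff p m"
  let ?G = "\<Sum>i\<in>basis_index n m k. ?a x i * ?a y i"
  \<comment> \<open>In the root block each vertex of the root copy has at most a unit coordinate
    vector of its own, and all other vertices have 0.\<close>
  have zero: "(\<Sum>u<k. ?a x (0, u) * ?a y (0, u)) = 0"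
    using ne by (auto simp: xy frame_coeff_def intro!: sum.neutral)
  have block: "?G = (\<Sum>t\<in>{1..<n}. if p t = r \<and> p t = s then real m + 2 + of_bool (v = w)
     else if t = r \<and> t = s then of_bool (v = w) - (real m + 2) / (real m + 1)\<^sup>2
     else if p t = r \<and> t = s \<or> t = r \<and> p t = s then of_bool (v = w)
     else 0)"
    unfolding sum_basis_index zero unfolding xy using frame_coeff_block[OF p _ b(2,4)]
    by (auto intro!: sum.cong)
  show ?thesis
  proof (cases "r = s")
    case True
    then have vw: "v \<noteq> w" using ne xy by simp
    let ?N = "card {t \<in> {1..<n}. p t = r}"
    let ?e = "(real m + 2) / (real m + 1)\<^sup>2"
    have "?G = (\<Sum>t\<in>{1..<n}. (if p t = r then real m + 2 else 0) - (if t = r then ?e else 0))"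
      unfolding block
    proof (rule sum.cong[OF refl])
      fix t assume "t \<in> {1..<n}"
      then have "p t \<noteq> t" using p[of t] by auto
      then show "(if p t = r \<and> p t = s then real m + 2 + of_bool (v = w)
          else if t = r \<and> t = s then of_bool (v = w) - ?e
          else if p t = r \<and> t = s \<or> t = r \<and> p t = s then of_bool (v = w) else 0) =
        (if p t = r then real m + 2 else 0) - (if t = r then ?e else 0)"
        using True vw by auto
    qed
    also have "\<dots> = (real m + 2) * ?N - (if r \<noteq> 0 then ?e else 0)"
      using b by (simp add: sum_subtractf sum.If_cases Int_def mult.commute)
    finally have G: "?G = (real m + 2) * ?N - (if r \<noteq> 0 then ?e else 0)" .
    have "?G \<noteq> 0"
    proof (cases "r = 0")
      case True
      \<comment> \<open>Since p 1 < 1, vertex 1 is a child of the root.\<close>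
      have "1 \<in> {t \<in> {1..<n}. p t = r}" using p[of 1] n True by auto
      then have "?N \<noteq> 0" by (auto simp: card_eq_0_iff)
      then show ?thesis using True by (simp add: G)
    next
      case False
      have e: "0 < ?e" "?e < real m + 2"
        using b(2) by (simp_all add: divide_less_eq power2_eq_square add_pos_nonneg algebra_simps)
      have "(real m + 2) * N \<noteq> e" if "e > 0" "e < real m + 2" for e and N :: nat
      proof (cases "N = 0")
        case False
        then have "(real m + 2) * 1 \<le> (real m + 2) * N" by (intro mult_left_mono) linarith+
        then have "e < (real m + 2) * N" using that(2) unfolding mult_1_right by (rule less_le_trans[rotated])
        then show ?thesis by (rule less_imp_neq[symmetric])
      qed (use that in simp)
      from this[OF e, of ?N] show ?thesis using False unfolding G by simp
    qed
    then show ?thesis using True vw xy by (simp add: prod_adj_def)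
  next
    case False
    have "?G = (\<Sum>t\<in>{1..<n}. of_bool (v = w \<and> (p t = r \<and> t = s \<or> t = r \<and> p t = s)))"
      unfolding block using False by (intro sum.cong) auto
    also have "\<dots> = real (card {t \<in> {1..<n}. v = w \<and> (p t = r \<and> t = s \<or> t = r \<and> p t = s)})"
      by (simp add: of_bool_def sum.If_cases Int_def conj_commute)
    finally have "?G \<noteq> 0 \<longleftrightarrow> (\<exists>t\<in>{1..<n}. v = w \<and> (p t = r \<and> t = s \<or> t = r \<and> p t = s))"
      by (auto simp: card_eq_0_iff)
    also have "\<dots> \<longleftrightarrow> prod_adj p x y"
      using False b by (auto simp: prod_adj_def tree_adj_def xy)
    finally show ?thesis .
  qed
qed

text \<open>Applied to the coordinates z of a vector orthogonal to the whole family, this shows that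
  the family spans. The equations are solved block by block towards the root, where invertibility of
  P^-1 kills each block.\<close>

lemma frame_coeff_injective:
  fixes z :: "nat \<times> nat \<Rightarrow> 'f::real_normed_field"
  assumes p: "\<And>i. 0 < i \<Longrightarrow> p i < i" and k: "k \<le> m" "0 < n"
    and zero: "\<And>x. x \<in> {..<n} \<times> {..<m} \<Longrightarrow>
      (\<Sum>i\<in>basis_index n m k. of_real (frame_coeff p m x i) * z i) = 0"
    and i: "i \<in> basis_index n m k"
  shows "z i = 0"
proof -
  let ?a = "frame_coeff p m"
  let ?c = "of_real (1 / (real m + 1)) :: 'f"
  have nonroot: "\<forall>u<m. z (t, u) = 0" if "0 < t" "t < n" for t
    using that
  \<comment> \<open>Children have larger numbers than their parent, so descending in t the blocks of
    all children of t have already been shown to vanish.\<close>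
  proof (induction "n - t" arbitrary: t rule: less_induct)
    case less
    let ?S = "\<Sum>u<m. z (t, u)"
    have zv: "z (t, v) = ?c * ?S" if v: "v < m" for v
    proof -
      have "0 = (\<Sum>i\<in>basis_index n m k. of_real (?a (t, v) i) * z i)"
        using zero[of "(t, v)"] v less.prems by simp
      also have "\<dots> = (\<Sum>i\<in>{t} \<times> {..<m}. of_real (?a (t, v) i) * z i)"
      proof (rule sum.mono_neutral_right)
        show "{t} \<times> {..<m} \<subseteq> basis_index n m k" using less.prems by (auto simp: basis_index_def)
        show "\<forall>i\<in>basis_index n m k - {t} \<times> {..<m}. of_real (?a (t, v) i) * z i = 0"
        proof
          fix i assume i: "i \<in> basis_index n m k - {t} \<times> {..<m}"
          show "of_real (?a (t, v) i) * z i = 0"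
          proof (cases "fst i \<noteq> 0 \<and> p (fst i) = t")
            case True
            then have "t < fst i" using p by auto
            moreover have "fst i < n" "snd i < m" using i True by (auto simp: basis_index_def)
            ultimately have "\<forall>u<m. z (fst i, u) = 0" "snd i < m"
              using less.hyps[of "fst i"] less.prems by auto
            then show ?thesis by (metis mult_zero_right prod.collapse)
          next
            case False
            moreover have "fst i \<noteq> t" using i less.prems by (auto simp: basis_index_def)
            ultimately show ?thesis by (auto simp: frame_coeff_def)
          qed
        qed
      qed simp
      also have "\<dots> = (\<Sum>u<m. of_real (?a (t, v) (t, u)) * z (t, u))"
        by (simp add: sum.cartesian_product')
      also have "\<dots> = (\<Sum>u<m. (if u = v then z (t, v) else 0) - ?c * z (t, u))"
        using less.prems p[of t] by (intro sum.cong) (auto simp: frame_coeff_def algebra_simps)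
      also have "\<dots> = z (t, v) - ?c * ?S"
        using v by (simp add: sum_subtractf sum_distrib_left)
      finally show ?thesis by simp
    qed
    \<comment> \<open>Summing z (t, v) = S/(m + 1) over v gives S = m/(m + 1) S, so S = 0 and every
      z (t, v) is 0.\<close>
    have "?S = (\<Sum>u<m. ?c * ?S)" by (intro sum.cong refl zv) simp
    then have "?S = of_real (real m / (real m + 1)) * ?S" by simp
    then have "of_real (1 - real m / (real m + 1)) * ?S = 0" by (simp add: algebra_simps)
    moreover have "1 - real m / (real m + 1) \<noteq> 0" by (simp add: field_simps)
    ultimately have "?S = 0" by (metis mult_eq_0_iff of_real_eq_0_iff)
    then show ?case using zv by (metis mult_zero_right)
  qed
  show ?thesis
  proof (cases "fst i = 0")
    case False
    then show ?thesis using nonroot[of "fst i"] i by (cases i) (auto simp: basis_index_def)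
  next
    case True
    then obtain v where v: "i = (0, v)" "v < k" using i by (cases i) (auto simp: basis_index_def)
    have "0 = (\<Sum>i\<in>basis_index n m k. of_real (?a (0, v) i) * z i)"
      using zero[of "(0, v)"] v k by simp
    also have "\<dots> = (\<Sum>i\<in>{(0, v)}. of_real (?a (0, v) i) * z i)"
    proof (rule sum.mono_neutral_right)
      show "\<forall>i\<in>basis_index n m k - {(0, v)}. of_real (?a (0, v) i) * z i = 0"
        using nonroot by (auto simp: basis_index_def frame_coeff_def)
    qed (use v i in auto)
    also have "\<dots> = z i" by (simp add: v frame_coeff_def)
    finally show ?thesis by simp
  qed
qed

context rc_inner_product_space
begin

lemma frame_family_exists:
  fixes p :: "nat \<Rightarrow> nat"
  assumes p: "\<And>i. 0 < i \<Longrightarrow> p i < i" and n: "2 \<le> n" and m: "1 \<le> m"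
    and d: "m * n - m \<le> dim H" "dim H \<le> m * n"
  obtains F :: "nat \<times> nat \<Rightarrow> 'v" where "F ` ({..<n} \<times> {..<m}) \<subseteq> H"
    "H \<subseteq> span (F ` ({..<n} \<times> {..<m}))"
    "\<And>x y. x \<in> {..<n} \<times> {..<m} \<Longrightarrow> y \<in> {..<n} \<times> {..<m} \<Longrightarrow> x \<noteq> y \<Longrightarrow>
      ip (F x) (F y) \<noteq> 0 \<longleftrightarrow> prod_adj p x y"
proof -
  let ?V = "{..<n} \<times> {..<m}" and ?a = "frame_coeff p m"
  \<comment> \<open>The excess over the minimal dimension; it makes \<open>basis_index n m k\<close>
    have exactly dim H elements.\<close>
  define k where "k = dim H - (m * n - m)"
  have k: "k \<le> m" using d n by (simp add: k_def le_diff_conv)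
  have mn: "m * n - m = (n - 1) * m" using n by (cases n) auto
  have "0 < (n - 1) * m" using n m by simp
  then have dim: "0 < dim H" using d(1) by (simp only: mn)
  let ?I = "basis_index n m k"
  obtain E where E: "orthonormal E" "card E = dim H" using orthonormal_extend by blast
  have fin: "finite E" and EH: "E \<subseteq> H" using E by (auto simp: orthonormal_def)
  have spE: "H \<subseteq> span E" by (rule orthonormal_spans[OF E dim])
  have "card ?I = card E"
    using d(1) by (simp add: card_basis_index E k_def mn)
  then obtain e where e: "bij_betw e ?I E"
    using finite_same_card_bij[OF finite_basis_index fin] by blast
  have eH: "e i \<in> H" if "i \<in> ?I" for i using bij_betwE[OF e] that EH by auto
  have e_ip: "ip (e i) (e j) = (if i = j then 1 else 0)" if "i \<in> ?I" "j \<in> ?I" for i j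
    using bij_betwE[OF e] that E bij_betw_imp_inj_on[OF e]
    by (auto simp: orthonormal_def inj_on_eq_iff)
  \<comment> \<open>The coefficients are real over either field, so the Gram matrix is the real one
    computed in \<open>frame_coeff_gram\<close>.\<close>
  define F where "F x = (\<Sum>i\<in>?I. scale (of_real (?a x i)) (e i))" for x
  have FH: "F x \<in> H" for x unfolding F_def by (intro H_sum H_scale eH)
  have ipF: "ip f (F x) = (\<Sum>i\<in>?I. of_real (?a x i) * ip f (e i))" if "f \<in> H" for f x
    unfolding F_def using that eH by (subst ip_sum_right) (auto simp: ip_scale_right)
  have gram: "ip (F x) (F y) = of_real (\<Sum>i\<in>?I. ?a x i * ?a y i)" for x y
  proof -
    have coord: "ip (F x) (e j) = of_real (?a x j)" if j: "j \<in> ?I" for j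
    proof -
      have "ip (F x) (e j) = (\<Sum>i\<in>?I. of_real (?a x i) * ip (e i) (e j))"
        unfolding F_def using j eH by (subst ip_sum_left) (auto simp: ip_scale_left)
      also have "\<dots> = (\<Sum>i\<in>?I. if i = j then of_real (?a x j) else 0)"
        using j by (intro sum.cong) (auto simp: e_ip)
      finally show ?thesis using j by simp
    qed
    show ?thesis unfolding ipF[OF FH] by (simp add: coord mult.commute)
  qed
  have "H \<subseteq> span (F ` ?V)"
  proof (rule ccontr)
    assume "\<not> H \<subseteq> span (F ` ?V)"
    then obtain f where f: "f \<in> H" "f \<noteq> 0" "\<forall>y\<in>F ` ?V. ip f y = 0"
      using orthogonal_exists[of "F ` ?V"] FH by auto
    have "ip f (e i) = 0" if "i \<in> ?I" for i
      using frame_coeff_injective[OF p k, of n "\<lambda>i. ip f (e i)" i] that f n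
      by (auto simp flip: ipF)
    then have "\<forall>y\<in>E. ip f y = 0" using bij_betw_imp_surj_on[OF e] by auto
    then have "ip f f = 0" using ip_span_eq_0[OF EH f(1)] f(1) spE by auto
    then show False using f ip_self_eq_0_iff by blast
  qed
  moreover have "ip (F x) (F y) \<noteq> 0 \<longleftrightarrow> prod_adj p x y" if "x \<in> ?V" "y \<in> ?V" "x \<noteq> y" for x y
    unfolding gram of_real_eq_0_iff by (rule frame_coeff_gram[OF p n k that])
  ultimately show ?thesis using that[of F] FH by blast
qed

end

section \<open>Frame graphs\<close>

text \<open>In a digraph of the form \<open>with_proj\<close> an arc is the pair of its ends, so the
  arc map of an isomorphism is determined by the vertex map.\<close>

lemma digraph_iso_with_proj_iff:
  assumes G: "pair_wf_digraph G" and C: "parcs C \<subseteq> pverts C \<times> pverts C"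
  shows "digraph_iso (with_proj G) (with_proj C) \<longleftrightarrow>
    (\<exists>g. bij_betw g (pverts G) (pverts C) \<and>
      (\<forall>u\<in>pverts G. \<forall>v\<in>pverts G. (g u, g v) \<in> parcs C \<longleftrightarrow> (u, v) \<in> parcs G))"
    (is "?L \<longleftrightarrow> ?R")
proof
  assume ?L
  then obtain h where h: "pre_digraph.digraph_isomorphism (with_proj G) h"
    and eq: "with_proj C = app_iso h (with_proj G)"
    by (auto simp: digraph_iso_def)
  let ?g = "iso_verts h"
  \<comment> \<open>Equality with \<open>with_proj C\<close> fixes the tail and head maps of h, so
    \<open>iso_arcs h\<close> sends an arc to the pair of images of its ends.\<close>
  have "fst = iso_tail h" "snd = iso_head h"
    using arg_cong[OF eq, of tail] arg_cong[OF eq, of head] by simp_all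
  then have "iso_arcs h (u, v) = (?g u, ?g v)" if "(u, v) \<in> parcs G" for u v
    using h that by (auto simp: pre_digraph.digraph_isomorphism_def prod_eq_iff)
  then have img: "iso_arcs h ` parcs G = (\<lambda>(u, v). (?g u, ?g v)) ` parcs G"
    by (intro image_cong) auto
  have inj: "inj_on ?g (pverts G)" using h by (auto simp: pre_digraph.digraph_isomorphism_def)
  have V: "pverts C = ?g ` pverts G" using arg_cong[OF eq, of verts] by simp
  have A: "parcs C = (\<lambda>(u, v). (?g u, ?g v)) ` parcs G"
    using arg_cong[OF eq, of arcs] img by simp
  have "(?g u, ?g v) \<in> parcs C \<longleftrightarrow> (u, v) \<in> parcs G" if uv: "u \<in> pverts G" "v \<in> pverts G" for u v
  proof
    assume "(?g u, ?g v) \<in> parcs C"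
    then obtain u' v' where e: "(u', v') \<in> parcs G" "?g u = ?g u'" "?g v = ?g v'"
      unfolding A by auto
    then have "u' \<in> pverts G" "v' \<in> pverts G"
      using pair_wf_digraph.in_arcsD1[OF G] pair_wf_digraph.in_arcsD2[OF G] by blast+
    then show "(u, v) \<in> parcs G" using e uv inj by (auto simp: inj_on_eq_iff)
  qed (auto simp: A)
  then show ?R using inj V by (intro exI[of _ ?g]) (simp add: bij_betw_def)
next
  assume ?R
  then obtain g where g: "bij_betw g (pverts G) (pverts C)"
    and adj: "\<And>u v. u \<in> pverts G \<Longrightarrow> v \<in> pverts G \<Longrightarrow> (g u, g v) \<in> parcs C \<longleftrightarrow> (u, v) \<in> parcs G"
    by blast
  have wf: "u \<in> pverts G" "v \<in> pverts G" if "(u, v) \<in> parcs G" for u v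
    using that pair_wf_digraph.in_arcsD1[OF G] pair_wf_digraph.in_arcsD2[OF G] by blast+
  define h where "h = \<lparr>iso_verts = g, iso_arcs = map_prod g g, iso_head = snd, iso_tail = fst\<rparr>"
  have inj: "inj_on g (pverts G)" and img: "g ` pverts G = pverts C"
    using g by (auto simp: bij_betw_def)
  have "inj_on (map_prod g g) (parcs G)"
    using map_prod_inj_on[OF inj inj] by (rule inj_on_subset) (use wf in auto)
  moreover have "wf_digraph (with_proj G)" using G by (simp add: wf_digraph_wp_iff)
  ultimately have "pre_digraph.digraph_isomorphism (with_proj G) h"
    using inj by (simp add: pre_digraph.digraph_isomorphism_def h_def)
  moreover have "parcs C = map_prod g g ` parcs G"
  proof
    show "parcs C \<subseteq> map_prod g g ` parcs G"
    proof
      fix e assume e: "e \<in> parcs C"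
      then obtain u v where uv: "u \<in> pverts G" "v \<in> pverts G" "e = (g u, g v)"
        using C img by (cases e) blast
      then show "e \<in> map_prod g g ` parcs G" using adj[OF uv(1,2)] e by force
    qed
    show "map_prod g g ` parcs G \<subseteq> parcs C" using adj wf by auto
  qed
  then have "with_proj C = app_iso h (with_proj G)"
    using img by (simp add: with_proj_def app_iso_def h_def)
  ultimately show ?L unfolding digraph_iso_def by blast
qed

context rc_inner_product_space
begin

text \<open>Trades the list and the isomorphism for a family indexed by a convenient set V, and the
  frame bounds for spanning. Only distinct indices are compared, because the graph has no loops
  while ip (F x) (F x) may be nonzero.\<close>

lemma is_frame_graph_in_iff_family:
  assumes fin: "finite V" and \<beta>: "bij_betw \<beta> V (pverts C)"
    and C: "parcs C \<subseteq> pverts C \<times> pverts C" "\<And>u. (u, u) \<notin> parcs C" and dim: "0 < dim H"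
  shows "is_frame_graph_in C ip H \<longleftrightarrow>
    (\<exists>F. F ` V \<subseteq> H \<and> H \<subseteq> span (F ` V) \<and>
      (\<forall>x\<in>V. \<forall>y\<in>V. x \<noteq> y \<longrightarrow> (ip (F x) (F y) \<noteq> 0 \<longleftrightarrow> (\<beta> x, \<beta> y) \<in> parcs C)))"
    (is "_ \<longleftrightarrow> (\<exists>F. ?P F)")
proof -
  have wf: "pair_wf_digraph (frame_graph ip \<phi>)" for \<phi>
    by unfold_locales (auto simp: frame_graph_def)
  show ?thesis
  proof
    assume "is_frame_graph_in C ip H"
    then obtain \<phi> g where frame: "finite_frame ip H \<phi>"
      and g: "bij_betw g {..<length \<phi>} (pverts C)"
      and adj: "\<And>i j. i < length \<phi> \<Longrightarrow> j < length \<phi> \<Longrightarrow>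
        (g i, g j) \<in> parcs C \<longleftrightarrow> i \<noteq> j \<and> ip (\<phi> ! i) (\<phi> ! j) \<noteq> 0"
      unfolding is_frame_graph_in_def digraph_iso_with_proj_iff[OF wf C(1)]
      by (auto simp: frame_graph_def)
    \<comment> \<open>s x is the position in \<phi> of the vector that sits at the vertex \<beta>
      x.\<close>
    define s where "s = the_inv_into {..<length \<phi>} g \<circ> \<beta>"
    have s: "bij_betw s V {..<length \<phi>}"
      unfolding s_def by (rule bij_betw_trans[OF \<beta> bij_betw_the_inv_into[OF g]])
    have gs: "g (s x) = \<beta> x" if "x \<in> V" for x
      using that g \<beta> unfolding s_def o_def
      by (intro f_the_inv_into_f_bij_betw[OF g]) (auto dest: bij_betwE)
    have sl: "s x < length \<phi>" if "x \<in> V" for x using bij_betwE[OF s] that by auto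
    have "(\<lambda>x. \<phi> ! s x) ` V = (!) \<phi> ` (s ` V)" by (simp add: image_image)
    also have "\<dots> = set \<phi>" using s by (auto simp: bij_betw_def in_set_conv_nth)
    finally have "(\<lambda>x. \<phi> ! s x) ` V = set \<phi>" .
    moreover have "ip (\<phi> ! s x) (\<phi> ! s y) \<noteq> 0 \<longleftrightarrow> (\<beta> x, \<beta> y) \<in> parcs C"
      if "x \<in> V" "y \<in> V" "x \<noteq> y" for x y
    proof -
      have "s x \<noteq> s y" using that s by (auto simp: bij_betw_def inj_on_eq_iff)
      then show ?thesis using adj[OF sl sl, of x y] that by (simp add: gs)
    qed
    moreover have "set \<phi> \<subseteq> H" using frame by (simp add: finite_frame_def)
    ultimately have "?P (\<lambda>x. \<phi> ! s x)" using frame_imp_spans[OF frame] by auto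
    then show "\<exists>F. ?P F" by (rule exI[where x = "\<lambda>x. \<phi> ! s x"])
  next
    assume "\<exists>F. ?P F"
    then obtain F where F: "F ` V \<subseteq> H" "H \<subseteq> span (F ` V)"
      and adj: "\<And>x y. x \<in> V \<Longrightarrow> y \<in> V \<Longrightarrow> x \<noteq> y \<Longrightarrow> ip (F x) (F y) \<noteq> 0 \<longleftrightarrow> (\<beta> x, \<beta> y) \<in> parcs C"
      by blast
    obtain vs where vs: "set vs = V" "distinct vs" using finite_distinct_list[OF fin] by blast
    \<comment> \<open>Listing the indices and not the image of F keeps repeated vectors as separate
      vertices.\<close>
    define \<phi> where "\<phi> = map F vs"
    have frame: "finite_frame ip H \<phi>"
      using F vs dim by (intro spans_imp_frame) (simp_all add: \<phi>_def)
    have b: "bij_betw ((!) vs) {..<length \<phi>} V"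
      using vs by (intro bij_betw_nth) (auto simp: \<phi>_def)
    have "(\<beta> (vs ! i), \<beta> (vs ! j)) \<in> parcs C \<longleftrightarrow> i \<noteq> j \<and> ip (\<phi> ! i) (\<phi> ! j) \<noteq> 0"
      if ij: "i < length \<phi>" "j < length \<phi>" for i j
    proof (cases "i = j")
      case True then show ?thesis using C(2) by simp
    next
      case False
      then have "vs ! i \<noteq> vs ! j" "vs ! i \<in> V" "vs ! j \<in> V"
        using vs ij by (auto simp: \<phi>_def nth_eq_iff_index_eq)
      then show ?thesis using adj[of "vs ! i" "vs ! j"] False ij by (simp add: \<phi>_def)
    qed
    then show "is_frame_graph_in C ip H"
      unfolding is_frame_graph_in_def digraph_iso_with_proj_iff[OF wf C(1)]
      using frame bij_betw_trans[OF b \<beta>]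
      by (intro exI[of _ \<phi>] conjI exI[of _ "\<beta> \<circ> (!) vs"]) (auto simp: frame_graph_def)
  qed
qed

lemma frame_graph_tree_product_iff:
  fixes T :: "'a pair_pre_digraph" and K :: "'b pair_pre_digraph"
  assumes m: "2 \<le> m" and n: "2 \<le> n"
    and T: "undirected_tree T" "card (pverts T) = n"
    and K: "complete_digraph m (with_proj K)"
    and dim: "0 < dim H"
  shows "is_frame_graph_in (cartesian_product T K) ip H \<longleftrightarrow> m * n - m \<le> dim H \<and> dim H \<le> m * n"
proof -
  let ?V = "{..<n} \<times> {..<m}" and ?C = "cartesian_product T K"
  obtain t p where t: "bij_betw t {..<n} (pverts T)" and p: "\<And>i. 0 < i \<Longrightarrow> p i < i"
    and tp: "\<And>i j. i < n \<Longrightarrow> j < n \<Longrightarrow> (t i, t j) \<in> parcs T \<longleftrightarrow> tree_adj p i j"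
    using undirected_tree_parent[OF T] n by auto
  have Kf: "finite (pverts K)" "card (pverts K) = m"
    and Ka: "parcs K = {(u, v). (u, v) \<in> pverts K \<times> pverts K \<and> u \<noteq> v}"
    using K by (simp_all add: complete_digraph_pair_def)
  obtain \<kappa> where \<kappa>: "bij_betw \<kappa> {..<m} (pverts K)"
    using finite_same_card_bij[of "{..<m}" "pverts K"] Kf by auto
  define \<beta> where "\<beta> = map_prod t \<kappa>"
  have \<beta>: "bij_betw \<beta> ?V (pverts ?C)"
    using bij_betw_map_prod[OF t \<kappa>] by (simp add: \<beta>_def cartesian_product_def)
  have loopT: "(u, u) \<notin> parcs T" for u
  proof -
    interpret pair_graph T using T by (simp add: undirected_tree_def)
    show ?thesis using no_loops by fastforce
  qed
  have C: "parcs ?C \<subseteq> pverts ?C \<times> pverts ?C" "\<And>u. (u, u) \<notin> parcs ?C"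
    using loopT by (auto simp: cartesian_product_def Ka)
  have adj: "(\<beta> x, \<beta> y) \<in> parcs ?C \<longleftrightarrow> prod_adj p x y" if xy: "x \<in> ?V" "y \<in> ?V" for x y
  proof -
    obtain i v j w where e: "x = (i, v)" "y = (j, w)" by (cases x, cases y)
    have b: "i < n" "v < m" "j < n" "w < m" using xy e by auto
    then have "t i \<in> pverts T" "t j \<in> pverts T" "\<kappa> v \<in> pverts K" "\<kappa> w \<in> pverts K"
      "t i = t j \<longleftrightarrow> i = j" "\<kappa> v = \<kappa> w \<longleftrightarrow> v = w"
      using bij_betwE[OF t] bij_betwE[OF \<kappa>] bij_betw_imp_inj_on[OF t] bij_betw_imp_inj_on[OF \<kappa>]
      by (auto simp: inj_on_eq_iff)
    then show ?thesis
      using tp[OF b(1,3)] by (auto simp: e \<beta>_def cartesian_product_def Ka prod_adj_def)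
  qed
  have mn: "m * n - m = (n - 1) * m" using n by (cases n) auto
  have iff: "is_frame_graph_in ?C ip H \<longleftrightarrow>
    (\<exists>F. F ` ?V \<subseteq> H \<and> H \<subseteq> span (F ` ?V) \<and>
      (\<forall>x\<in>?V. \<forall>y\<in>?V. x \<noteq> y \<longrightarrow> (ip (F x) (F y) \<noteq> 0 \<longleftrightarrow> prod_adj p x y)))"
    unfolding is_frame_graph_in_iff_family[OF finite_cartesian_product[OF finite_lessThan finite_lessThan] \<beta> C dim]
    by (simp only: adj cong: ball_cong)
  show ?thesis
  proof
    assume "is_frame_graph_in ?C ip H"
    then obtain F where frame: "F ` ?V \<subseteq> H \<and> H \<subseteq> span (F ` ?V) \<and>
        (\<forall>x\<in>?V. \<forall>y\<in>?V. x \<noteq> y \<longrightarrow> (ip (F x) (F y) \<noteq> 0 \<longleftrightarrow> prod_adj p x y))"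
      unfolding iff by (rule exE)
    have F: "F ` ?V \<subseteq> H" "H \<subseteq> span (F ` ?V)"
      using frame[THEN conjunct1] frame[THEN conjunct2, THEN conjunct1] .
    have Fadj: "ip (F x) (F y) \<noteq> 0 \<longleftrightarrow> prod_adj p x y" if "x \<in> ?V" "y \<in> ?V" "x \<noteq> y" for x y
      using frame[THEN conjunct2, THEN conjunct2, rule_format, OF that] .
    have "dim H \<le> card (F ` ?V)" using F(2) by (intro dim_le_card) auto
    also have "\<dots> \<le> card ?V" by (rule card_image_le) simp
    finally have upper: "dim H \<le> m * n" by (simp add: mult.commute)
    \<comment> \<open>The vectors off the root copy are independent, and there are (n - 1) m of
      them.\<close>
    have "card ({1..<n} \<times> {..<m}) \<le> dim H"
    proof (rule independent_family_card_le_dim[of _ F])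
      show "F ` ({1..<n} \<times> {..<m}) \<subseteq> H" using F(1) by auto
      show "\<forall>x\<in>{1..<n} \<times> {..<m}. c x = 0"
        if "(\<Sum>x\<in>{1..<n} \<times> {..<m}. scale (c x) (F x)) = 0" for c
        by (rule nonroot_independent[OF p _ Fadj that]) (use F(1) in auto)
    qed (use dim in auto)
    with upper show "m * n - m \<le> dim H \<and> dim H \<le> m * n" by (simp add: mn)
  next
    assume d: "m * n - m \<le> dim H \<and> dim H \<le> m * n"
    have m1: "1 \<le> m" using m by simp
    show "is_frame_graph_in ?C ip H"
    proof (rule frame_family_exists[OF p n m1 conjunct1[OF d] conjunct2[OF d]])
      fix F
      assume F: "F ` ?V \<subseteq> H" "H \<subseteq> span (F ` ?V)"
        "\<And>x y. x \<in> ?V \<Longrightarrow> y \<in> ?V \<Longrightarrow> x \<noteq> y \<Longrightarrow> ip (F x) (F y) \<noteq> 0 \<longleftrightarrow> prod_adj p x y"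
      show "is_frame_graph_in ?C ip H"
        unfolding iff by (intro exI[of _ F] conjI ballI impI F)
    qed
  qed
qed

end

section \<open>The real and the complex case\<close>

lemma rc_inner_product_space_real:
  fixes scale :: "real \<Rightarrow> 'v::ab_group_add \<Rightarrow> 'v"
  assumes "inner_product_space scale ip H"
  shows "rc_inner_product_space scale ip H"
  using assms by (simp add: rc_inner_product_space_def rc_inner_product_space_axioms_def power2_eq_square)

lemma rc_inner_product_space_complex:
  fixes scale :: "complex \<Rightarrow> 'v::ab_group_add \<Rightarrow> 'v"
  assumes "inner_product_space scale ip H"
  shows "rc_inner_product_space scale ip H"
proof (intro rc_inner_product_space.intro rc_inner_product_space_axioms.intro assms)
  show "x * conjugate x = of_real ((norm x)\<^sup>2)" for x :: complex
    by (simp only: complex_norm_square conjugate_complex_def)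
  show "x = of_real (norm x)" if "0 < x" for x :: complex
    using that by (auto simp: less_complex_def complex_eq_iff cmod_def)
qed

theorem theorem3p7:
  fixes m n d :: nat
    and T :: "'a pair_pre_digraph"
    and K :: "'b pair_pre_digraph"
  assumes "2 \<le> m" and "2 \<le> n"
    and "undirected_tree T" and "card (pverts T) = n"
    and "complete_digraph m (with_proj K)"
    and "1 \<le> d"
  shows "(\<forall>(scale :: real \<Rightarrow> 'v::ab_group_add \<Rightarrow> 'v) ip H.
            inner_product_space scale ip H \<and> vector_space.dim scale H = d \<longrightarrow>
            (is_frame_graph_in (cartesian_product T K) ip H \<longleftrightarrow> m * n - m \<le> d \<and> d \<le> m * n)) \<and>
         (\<forall>(scale :: complex \<Rightarrow> 'w::ab_group_add \<Rightarrow> 'w) ip H.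
            inner_product_space scale ip H \<and> vector_space.dim scale H = d \<longrightarrow>
            (is_frame_graph_in (cartesian_product T K) ip H \<longleftrightarrow> m * n - m \<le> d \<and> d \<le> m * n))"
proof (intro conjI allI impI; elim conjE)
  fix scale :: "real \<Rightarrow> 'v \<Rightarrow> 'v" and ip H
  assume ips: "inner_product_space scale ip H" and d: "vector_space.dim scale H = d"
  show "is_frame_graph_in (cartesian_product T K) ip H \<longleftrightarrow> m * n - m \<le> d \<and> d \<le> m * n"
    \<comment> \<open>From \<open>1 \<le> d\<close> the dimension is positive, hence H is
      finite-dimensional.\<close>
    using rc_inner_product_space.frame_graph_tree_product_iff
      [OF rc_inner_product_space_real[OF ips] assms(1-5)] assms(6) unfolding d by linarith
next
  fix scale :: "complex \<Rightarrow> 'w \<Rightarrow> 'w" and ip H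
  assume ips: "inner_product_space scale ip H" and d: "vector_space.dim scale H = d"
  show "is_frame_graph_in (cartesian_product T K) ip H \<longleftrightarrow> m * n - m \<le> d \<and> d \<le> m * n"
    using rc_inner_product_space.frame_graph_tree_product_iff
      [OF rc_inner_product_space_complex[OF ips] assms(1-5)] assms(6) unfolding d by linarith
qed

end
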